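(* Let $0\le\alpha<\frac{\pi}{2}$, let $k\ge1$, let $A_1,\dots,A_k,B_1,\dots,B_k\in\Pi_n^{\alpha}$ and let $\sigma=\sigma_f$ for some $f\in\mathfrak{m}$. Then $$\sum_{i=1}^{k}\mathfrak{R}A_i\,\sharp\,\mathfrak{R}B_i\le\left(\sum_{i=1}^{k}\mathfrak{R}A_i\,\sigma\,\mathfrak{R}B_i\right)\sharp\left(\sum_{i=1}^{k}\mathfrak{R}A_i\,\sigma^{\perp}\,\mathfrak{R}B_i\right)\le\sec^2\alpha\;\left(\mathfrak{R}\left(\sum_{i=1}^{k}A_i\right)\sharp\,\mathfrak{R}\left(\sum_{i=1}^{k}B_i\right)\right).$$
   Context: $\mathcal{M}_n$ is the algebra of $n\times n$ complex matrices, $\mathfrak{R}A=\frac{A+A^*}{2}$ is the real part of $A\in\mathcal{M}_n$, and for Hermitian $X,Y$, $X\le Y$ means that $Y-X$ is positive semidefinite. For $0\le\alpha<\pi/2$, $\Pi_n^{\alpha}$ is the set of $A\in\mathcal{M}_n$ such that for every unit vector $x\in\mathbb{C}^n$ the number $z=\langle Ax,x\rangle$ satisfies $\mathfrak{R}(z)>0$ and $|\mathfrak{I}(z)|\le(\tan\alpha)\,\mathfrak{R}(z)$. $\mathfrak{m}$ is the set of functions $f:(0,\infty)\to(0,\infty)$ with $f(1)=1$ that are operator (matrix) monotone, i.e. $f(X)\le f(Y)$ whenever $0<X\le Y$ are positive definite matrices of any size. For positive definite $X,Y\in\mathcal{M}_n$ and $f\in\mathfrak{m}$, the operator mean is $X\sigma_fY=X^{1/2}f(X^{-1/2}YX^{-1/2})X^{1/2}$;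 $\sharp$ is the geometric mean, i.e. $\sigma_f$ with $f(x)=x^{1/2}$; and for $\sigma=\sigma_f$, $\sigma^{\perp}$ denotes the operator mean associated with the function $x\mapsto\frac{x}{f(x)}$ (which again belongs to $\mathfrak{m}$). Inside the sums, $\mathfrak{R}A_i\,\sigma\,\mathfrak{R}B_i$ means $(\mathfrak{R}A_i)\sigma(\mathfrak{R}B_i)$, and similarly for $\sharp$ and $\sigma^\perp$. *)

theory Defs
  imports "Jordan_Normal_Form.Schur_Decomposition"
begin

text \<open>
  The matrices are those of Jordan_Normal_Form, whose dimensions are values rather than types:
  operator monotonicity quantifies over matrices of every size. The inner product
  \<open>\<langle>Ax, x\<rangle>\<close> is \<open>(A *\<^sub>v x) \<bullet>c x\<close> (linear in the first argument).
\<close>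

definition hermitian_mat :: "nat \<Rightarrow> complex mat \<Rightarrow> bool" where
  "hermitian_mat n A \<longleftrightarrow> A \<in> carrier_mat n n \<and> mat_adjoint A = A"

definition pos_semidef :: "nat \<Rightarrow> complex mat \<Rightarrow> bool" where
  "pos_semidef n A \<longleftrightarrow>
     hermitian_mat n A \<and> (\<forall>x \<in> carrier_vec n. Re ((A *\<^sub>v x) \<bullet>c x) \<ge> 0)"

definition pos_def :: "nat \<Rightarrow> complex mat \<Rightarrow> bool" where
  "pos_def n A \<longleftrightarrow>
     hermitian_mat n A \<and> (\<forall>x \<in> carrier_vec n. x \<noteq> 0\<^sub>v n \<longrightarrow> Re ((A *\<^sub>v x) \<bullet>c x) > 0)"

text \<open>The order \<open>\<le>\<close> that the library puts on matrices is entrywise, so the Loewner order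
  needs its own name.\<close>

definition loewner_le :: "nat \<Rightarrow> complex mat \<Rightarrow> complex mat \<Rightarrow> bool" where
  "loewner_le n X Y \<longleftrightarrow>
     hermitian_mat n X \<and> hermitian_mat n Y \<and> pos_semidef n (Y - X)"

definition re_mat :: "complex mat \<Rightarrow> complex mat" where
  "re_mat A = (1 / 2) \<cdot>\<^sub>m (A + mat_adjoint A)"

definition sector_mats :: "nat \<Rightarrow> real \<Rightarrow> complex mat set" where
  "sector_mats n \<alpha> =
     {A \<in> carrier_mat n n. \<forall>x \<in> carrier_vec n. x \<bullet>c x = 1 \<longrightarrow>
        Re ((A *\<^sub>v x) \<bullet>c x) > 0 \<and>
        \<bar>Im ((A *\<^sub>v x) \<bullet>c x)\<bar> \<le> tan \<alpha> * Re ((A *\<^sub>v x) \<bullet>c x)}"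

definition mat_sum :: "nat \<Rightarrow> ('i \<Rightarrow> complex mat) \<Rightarrow> 'i set \<Rightarrow> complex mat" where
  "mat_sum n F I = mat n n (\<lambda>(r, c). \<Sum>i\<in>I. F i $$ (r, c))"

text \<open>\<open>A = U diag(d) U\<^sup>*\<close> with \<open>U\<close> unitary and \<open>d\<close> real.\<close>

definition unitary_diag :: "nat \<Rightarrow> complex mat \<Rightarrow> complex mat \<Rightarrow> (nat \<Rightarrow> real) \<Rightarrow> bool" where
  "unitary_diag n A U d \<longleftrightarrow>
     U \<in> carrier_mat n n \<and> U * mat_adjoint U = 1\<^sub>m n \<and> mat_adjoint U * U = 1\<^sub>m n \<and>
     A = U * mat_diag n (\<lambda>i. complex_of_real (d i)) * mat_adjoint U"

text \<open>Functional calculus of a Hermitian matrix: \<open>f(A) = U diag(f \<circ> d) U\<^sup>*\<close>. The result does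
  not depend on the chosen diagonalization, see \<open>mat_fun_eq\<close> below; it is a junk value if
  \<open>A\<close> is not Hermitian.\<close>

definition mat_fun :: "(real \<Rightarrow> real) \<Rightarrow> complex mat \<Rightarrow> complex mat" where
  "mat_fun f A = (THE B. \<exists>U d. unitary_diag (dim_row A) A U d \<and>
     B = U * mat_diag (dim_row A) (\<lambda>i. complex_of_real (f (d i))) * mat_adjoint U)"

lemma mat_adjoint_carrier:
  "A \<in> carrier_mat n m \<Longrightarrow> mat_adjoint A \<in> carrier_mat m n"
  by (auto simp: mat_adjoint_def mat_of_rows_def)

lemma unitary_diag_fun_unique:
  assumes "unitary_diag n A U d" and "unitary_diag n A V e"
  shows "U * mat_diag n (\<lambda>i. complex_of_real (f (d i))) * mat_adjoint U =
         V * mat_diag n (\<lambda>i. complex_of_real (f (e i))) * mat_adjoint V"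
proof -
  define D where "D = mat_diag n (\<lambda>i. complex_of_real (d i))"
  define E where "E = mat_diag n (\<lambda>i. complex_of_real (e i))"
  define fD where "fD = mat_diag n (\<lambda>i. complex_of_real (f (d i)))"
  define fE where "fE = mat_diag n (\<lambda>i. complex_of_real (f (e i)))"
  define U' where "U' = mat_adjoint U"
  define V' where "V' = mat_adjoint V"
  define W where "W = V' * U"
  have c: "U \<in> carrier_mat n n" "V \<in> carrier_mat n n" "U' \<in> carrier_mat n n"
    "V' \<in> carrier_mat n n" "W \<in> carrier_mat n n" "D \<in> carrier_mat n n" "E \<in> carrier_mat n n"
    "fD \<in> carrier_mat n n" "fE \<in> carrier_mat n n"
    using assms by (auto simp: unitary_diag_def D_def E_def fD_def fE_def U'_def V'_def W_def
      intro!: mat_adjoint_carrier mult_carrier_mat)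
  have u: "U' * U = 1\<^sub>m n" "U * U' = 1\<^sub>m n" "V' * V = 1\<^sub>m n" "V * V' = 1\<^sub>m n"
    and eq: "U * D * U' = V * E * V'"
    using assms by (auto simp: unitary_diag_def U'_def V'_def D_def E_def)
  note [simp] = c mult_carrier_mat[where n = n]
    left_mult_one_mat[where nr = n and nc = n] right_mult_one_mat[where nr = n and nc = n]
  and a = assoc_mult_mat[where ?n\<^sub>1 = n and ?n\<^sub>2 = n and ?n\<^sub>3 = n and ?n\<^sub>4 = n]
  have "W * D = V' * (U * D * U') * U"
    using u(1) by (simp add: W_def a)
  also have "\<dots> = E * W"
  proof -
    have "V' * (V * E * V') * U = (V' * V) * E * (V' * U)"
      by (simp add: a)
    then show ?thesis using eq u(3) by (simp add: W_def)
  qed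
  finally have WD: "W * D = E * W" .
  have "W * fD = fE * W"
  proof (rule eq_matI)
    fix i j assume "i < dim_row (fE * W)" "j < dim_col (fE * W)"
    then have ij: "i < n" "j < n" using c by auto
    have "W $$ (i, j) * complex_of_real (d j) = complex_of_real (e i) * W $$ (i, j)"
      using arg_cong[OF WD, of "\<lambda>M. M $$ (i, j)"] ij c
      by (simp add: D_def E_def mat_diag_mult_left[of W n n] mat_diag_mult_right[of W n n])
    then have "W $$ (i, j) = 0 \<or> d j = e i" by auto
    then show "(W * fD) $$ (i, j) = (fE * W) $$ (i, j)"
      using ij c
      by (auto simp: fD_def fE_def mat_diag_mult_left[of W n n] mat_diag_mult_right[of W n n])
  qed (use carrier_matD[OF c(5)] carrier_matD[OF c(8)] carrier_matD[OF c(9)] in simp_all)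
  then have "V * (W * fD) * U' = V * (fE * W) * U'" by simp
  moreover have "V * (W * fD) * U' = (V * V') * U * fD * U'"
    by (simp add: W_def a)
  moreover have "V * (fE * W) * U' = V * fE * V' * (U * U')"
    by (simp add: W_def a)
  ultimately have "U * fD * U' = V * fE * V'" using u by simp
  then show ?thesis by (simp add: fD_def fE_def U'_def V'_def)
qed

lemma mat_fun_eq:
  assumes "unitary_diag n A U d"
  shows "mat_fun f A = U * mat_diag n (\<lambda>i. complex_of_real (f (d i))) * mat_adjoint U"
proof -
  have n: "dim_row A = n" using assms by (auto simp: unitary_diag_def)
  show ?thesis unfolding mat_fun_def n
    by (rule the_equality) (use assms unitary_diag_fun_unique in blast)+
qed

text \<open>The functions \<open>f : (0,\<infinity>) \<rightarrow> (0,\<infinity>)\<close> are total functions here; only their values at positive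
  arguments matter, since they are only applied to positive definite matrices.\<close>

definition operator_monotone :: "(real \<Rightarrow> real) \<Rightarrow> bool" where
  "operator_monotone f \<longleftrightarrow>
     (\<forall>n X Y. pos_def n X \<and> pos_def n Y \<and> loewner_le n X Y \<longrightarrow>
        loewner_le n (mat_fun f X) (mat_fun f Y))"

definition op_mono_class :: "(real \<Rightarrow> real) set" where
  "op_mono_class = {f. (\<forall>x>0. f x > 0) \<and> f 1 = 1 \<and> operator_monotone f}"

definition op_mean :: "(real \<Rightarrow> real) \<Rightarrow> complex mat \<Rightarrow> complex mat \<Rightarrow> complex mat" where
  "op_mean f X Y =
     (let R = mat_fun sqrt X; S = mat_fun (\<lambda>t. 1 / sqrt t) X
      in R * mat_fun f (S * Y * S) * R)"

abbreviation geom_mean :: "complex mat \<Rightarrow> complex mat \<Rightarrow> complex mat" where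
  "geom_mean \<equiv> op_mean sqrt"

definition perp_fun :: "(real \<Rightarrow> real) \<Rightarrow> real \<Rightarrow> real" where
  "perp_fun f = (\<lambda>x. x / f x)"

end

theory Submission
  imports Defs "Jordan_Normal_Form.Spectral_Radius"
begin

text \<open>
  Write \<open>a\<^sub>i\<close>, \<open>b\<^sub>i\<close> for the real parts. Positive definite \<open>A\<close>, \<open>B\<close> are simultaneously congruent to
  diagonal matrices, \<open>A = Z\<^sup>H Z\<close> and \<open>B = Z\<^sup>H D Z\<close>, and then \<open>A \<sigma> B = Z\<^sup>H f(D) Z\<close>. Hence
  \<open>(a\<^sub>i \<sigma> b\<^sub>i) \<sharp> (a\<^sub>i \<sigma>\<^sup>\<bottom> b\<^sub>i) = a\<^sub>i \<sharp> b\<^sub>i\<close>, so the first inequality is the superadditivity of \<open>\<sharp>\<close>. For the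
  second one, superadditivity of \<open>\<sigma>\<close> and \<open>\<sigma>\<^sup>\<bottom>\<close> and monotonicity of \<open>\<sharp>\<close> bound the middle term even by
  \<open>(\<Sum> a\<^sub>i) \<sharp> (\<Sum> b\<^sub>i)\<close>. Since \<open>A \<sigma>\<^sup>\<bottom> B = B \<sigma>\<^sub>g A\<close> for the operator monotone function \<open>g(x) = 1 / f(1 / x)\<close>,
  only superadditivity of \<open>\<sigma>\<^sub>f\<close> is needed, which is Jensen's operator inequality for \<open>f\<close>. The latter
  follows from monotonicity alone by a unitary dilation to size \<open>2n\<close>; no continuity of \<open>f\<close> is used, because
  the error \<open>\<epsilon>\<close> of the dilation enters as a factor \<open>1 + \<epsilon>\<close> of the argument and \<open>f(x) / x\<close> is nonincreasing.
\<close>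

notation mat_adjoint ("_\<^sup>H" [1000] 999)

section \<open>Adjoints and quadratic forms\<close>

lemma dim_mat_adjoint [simp]: "dim_row (A\<^sup>H) = dim_col A" "dim_col (A\<^sup>H) = dim_row A"
  by (auto simp: mat_adjoint_def mat_of_rows_def)

lemma index_mat_adjoint [simp]:
  "i < dim_col A \<Longrightarrow> j < dim_row A \<Longrightarrow> A\<^sup>H $$ (i, j) = conjugate (A $$ (j, i))"
  by (auto simp: mat_adjoint_def mat_of_rows_def)

lemmas mat_adjoint_carrier_simp [simp] = mat_adjoint_carrier

lemma mat_adjoint_adjoint [simp]: "(A\<^sup>H)\<^sup>H = (A :: complex mat)"
  by (rule eq_matI) auto

lemma mat_adjoint_mult [simp]:
  fixes A B :: "complex mat"
  assumes "A \<in> carrier_mat n m" and "B \<in> carrier_mat m k"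
  shows "(A * B)\<^sup>H = B\<^sup>H * A\<^sup>H"
  using assms by (intro eq_matI) (auto simp: scalar_prod_def mult.commute intro!: sum.cong)

lemma mat_adjoint_add:
  fixes A B :: "complex mat"
  assumes "A \<in> carrier_mat n m" and "B \<in> carrier_mat n m"
  shows "(A + B)\<^sup>H = A\<^sup>H + B\<^sup>H"
  using assms by (intro eq_matI) auto

lemma mat_adjoint_minus:
  fixes A B :: "complex mat"
  assumes "A \<in> carrier_mat n m" and "B \<in> carrier_mat n m"
  shows "(A - B)\<^sup>H = A\<^sup>H - B\<^sup>H"
  using assms by (intro eq_matI) auto

lemma mat_adjoint_smult: "(c \<cdot>\<^sub>m A)\<^sup>H = cnj c \<cdot>\<^sub>m A\<^sup>H"
  by (intro eq_matI) auto

lemma mat_adjoint_one [simp]: "(1\<^sub>m n)\<^sup>H = (1\<^sub>m n :: complex mat)"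
  by (intro eq_matI) auto

lemma mat_adjoint_four_block:
  fixes A B C D :: "complex mat"
  assumes "A \<in> carrier_mat n1 m1" "B \<in> carrier_mat n1 m2" "C \<in> carrier_mat n2 m1"
    "D \<in> carrier_mat n2 m2"
  shows "(four_block_mat A B C D)\<^sup>H = four_block_mat (A\<^sup>H) (C\<^sup>H) (B\<^sup>H) (D\<^sup>H)"
  using assms by (intro eq_matI) auto

abbreviation rdiag :: "nat \<Rightarrow> (nat \<Rightarrow> real) \<Rightarrow> complex mat" where
  "rdiag n d \<equiv> mat_diag n (\<lambda>i. complex_of_real (d i))"

lemma mat_adjoint_rdiag [simp]: "(rdiag n d)\<^sup>H = rdiag n d"
  by (intro eq_matI) (auto simp: mat_diag_def)

lemma rdiag_cong: "(\<And>i. i < n \<Longrightarrow> d i = e i) \<Longrightarrow> rdiag n d = rdiag n e"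
  by (intro eq_matI) (auto simp: mat_diag_def)

lemma rdiag_one: "rdiag n (\<lambda>i. 1) = 1\<^sub>m n"
  by simp

text \<open>On Hermitian matrices the form is real, so the real part loses nothing there; it makes
  every positivity statement an inequality between reals.\<close>

definition qform :: "complex mat \<Rightarrow> complex vec \<Rightarrow> real" where
  "qform A x = Re ((A *\<^sub>v x) \<bullet>c x)"

lemma adjoint_cscalar_prod:
  fixes M :: "complex mat"
  assumes "M \<in> carrier_mat m n" and "v \<in> carrier_vec n" and "w \<in> carrier_vec m"
  shows "(M *\<^sub>v v) \<bullet>c w = v \<bullet>c (M\<^sup>H *\<^sub>v w)"
proof -
  have "(M *\<^sub>v v) \<bullet>c w = (\<Sum>i<m. \<Sum>j<n. M $$ (i, j) * v $ j * cnj (w $ i))"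
    using assms by (simp add: scalar_prod_def sum_distrib_right atLeast0LessThan)
  also have "\<dots> = (\<Sum>j<n. \<Sum>i<m. M $$ (i, j) * v $ j * cnj (w $ i))"
    by (rule sum.swap)
  also have "\<dots> = v \<bullet>c (M\<^sup>H *\<^sub>v w)"
    using assms
    by (simp add: scalar_prod_def sum_distrib_left atLeast0LessThan mult_ac)
  finally show ?thesis .
qed

text \<open>The source of all congruence facts: a congruence only substitutes
  \<open>Z *\<^sub>v x\<close> for \<open>x\<close> in the form. \<open>Z\<close> may be
  rectangular.\<close>

lemma qform_congruence:
  assumes "A \<in> carrier_mat m m" and "Z \<in> carrier_mat m n" and "x \<in> carrier_vec n"
  shows "qform (Z\<^sup>H * A * Z) x = qform A (Z *\<^sub>v x)"
proof -
  have "(Z\<^sup>H * A * Z) *\<^sub>v x = Z\<^sup>H *\<^sub>v (A *\<^sub>v (Z *\<^sub>v x))"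
    using assms
    by (simp add: assoc_mult_mat_vec[where ?n\<^sub>1 = n and ?n\<^sub>2 = m and ?n\<^sub>3 = n]
        assoc_mult_mat_vec[where ?n\<^sub>1 = n and ?n\<^sub>2 = m and ?n\<^sub>3 = m]
        assoc_mult_mat[where ?n\<^sub>1 = n and ?n\<^sub>2 = m and ?n\<^sub>3 = m and ?n\<^sub>4 = n])
  then show ?thesis
    using adjoint_cscalar_prod[of "Z\<^sup>H" n m "A *\<^sub>v (Z *\<^sub>v x)" x] assms by (simp add: qform_def)
qed

lemma qform_zero: "A \<in> carrier_mat n n \<Longrightarrow> qform A (0\<^sub>v n) = 0"
  using mult_mat_vec_carrier[of A n n "0\<^sub>v n"] by (simp add: qform_def)

lemma qform_add:
  assumes "A \<in> carrier_mat n n" "B \<in> carrier_mat n n" "x \<in> carrier_vec n"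
  shows "qform (A + B) x = qform A x + qform B x"
  using assms by (simp add: qform_def add_mult_distrib_mat_vec add_scalar_prod_distrib[of _ n])

lemma qform_minus:
  assumes "A \<in> carrier_mat n n" "B \<in> carrier_mat n n" "x \<in> carrier_vec n"
  shows "qform (A - B) x = qform A x - qform B x"
  using assms by (simp add: qform_def minus_mult_distrib_mat_vec minus_scalar_prod_distrib[of _ n])

lemma smult_mat_mult_vec:
  "A \<in> carrier_mat n m \<Longrightarrow> x \<in> carrier_vec m \<Longrightarrow> (c \<cdot>\<^sub>m A) *\<^sub>v x = c \<cdot>\<^sub>v (A *\<^sub>v (x :: complex vec))"
  by (intro eq_vecI) auto

lemma qform_smult:
  assumes "A \<in> carrier_mat n n" "x \<in> carrier_vec n"
  shows "qform (complex_of_real c \<cdot>\<^sub>m A) x = c * qform A x"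
  using assms by (simp add: qform_def smult_mat_mult_vec)

lemma qform_rdiag:
  assumes "x \<in> carrier_vec n"
  shows "qform (rdiag n d) x = (\<Sum>i<n. d i * (cmod (x $ i))\<^sup>2)"
proof -
  have "(rdiag n d) *\<^sub>v x = vec n (\<lambda>i. complex_of_real (d i) * x $ i)"
    using assms by (intro eq_vecI) (auto simp: mat_diag_def scalar_prod_def if_distrib[of "\<lambda>a. a * _"] sum.delta cong: if_cong)
  then show ?thesis
    using assms by (simp add: qform_def scalar_prod_def atLeast0LessThan mult.assoc
        complex_norm_square[symmetric] power2_eq_square flip: of_real_mult of_real_power)
qed

section \<open>Hermitian and positive definite matrices, the Loewner order and congruence\<close>

lemma carrier_mat_hermitian: "hermitian_mat n A \<Longrightarrow> A \<in> carrier_mat n n"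
  by (simp add: hermitian_mat_def)

lemma pos_semidef_iff: "pos_semidef n A \<longleftrightarrow> hermitian_mat n A \<and> (\<forall>x\<in>carrier_vec n. qform A x \<ge> 0)"
  by (simp add: pos_semidef_def qform_def)

lemma pos_def_iff:
  "pos_def n A \<longleftrightarrow> hermitian_mat n A \<and> (\<forall>x\<in>carrier_vec n. x \<noteq> 0\<^sub>v n \<longrightarrow> qform A x > 0)"
  by (simp add: pos_def_def qform_def)

lemma pos_def_hermitian: "pos_def n A \<Longrightarrow> hermitian_mat n A"
  by (simp add: pos_def_def)

lemma pos_def_carrier: "pos_def n A \<Longrightarrow> A \<in> carrier_mat n n"
  by (simp add: pos_def_def hermitian_mat_def)

lemma hermitian_minus: "hermitian_mat n X \<Longrightarrow> hermitian_mat n Y \<Longrightarrow> hermitian_mat n (X - Y)"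
  by (auto simp: hermitian_mat_def mat_adjoint_minus[of _ n n] intro: minus_carrier_mat)

lemma hermitian_add: "hermitian_mat n X \<Longrightarrow> hermitian_mat n Y \<Longrightarrow> hermitian_mat n (X + Y)"
  by (auto simp: hermitian_mat_def mat_adjoint_add[of _ n n])

lemma hermitian_smult: "hermitian_mat n X \<Longrightarrow> hermitian_mat n (complex_of_real c \<cdot>\<^sub>m X)"
  by (auto simp: hermitian_mat_def mat_adjoint_smult)

lemma hermitian_rdiag: "hermitian_mat n (rdiag n d)"
  by (simp add: hermitian_mat_def)

lemma hermitian_congruence:
  assumes "hermitian_mat m A" and "Z \<in> carrier_mat m n"
  shows "hermitian_mat n (Z\<^sup>H * A * Z)"
proof -
  have A: "A \<in> carrier_mat m m" "A\<^sup>H = A" using assms(1) by (auto simp: hermitian_mat_def)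
  have "(Z\<^sup>H * A * Z)\<^sup>H = Z\<^sup>H * (A * Z)"
    using A assms(2) by (simp add: mat_adjoint_mult[OF mult_carrier_mat[OF mat_adjoint_carrier[OF assms(2)] A(1)] assms(2)]
      mat_adjoint_mult[OF mat_adjoint_carrier[OF assms(2)] A(1)])
  also have "\<dots> = Z\<^sup>H * A * Z"
    using A assms(2) by (simp add: assoc_mult_mat[where ?n\<^sub>1 = n and ?n\<^sub>2 = m and ?n\<^sub>3 = m and ?n\<^sub>4 = n])
  finally show ?thesis
    using A assms(2) by (simp add: hermitian_mat_def mult_carrier_mat[where n = m])
qed

text \<open>Trades the semidefinite difference for a pointwise comparison of forms, so that
  transitivity, sums and congruence become statements about real numbers.\<close>

lemma loewner_le_iff:
  "loewner_le n X Y \<longleftrightarrow> hermitian_mat n X \<and> hermitian_mat n Y \<and>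
     (\<forall>x\<in>carrier_vec n. qform X x \<le> qform Y x)"
  by (auto simp: loewner_le_def pos_semidef_iff qform_minus hermitian_mat_def
      mat_adjoint_minus[of _ n n] intro!: minus_carrier_mat)

lemma loewner_le_trans: "loewner_le n X Y \<Longrightarrow> loewner_le n Y Z \<Longrightarrow> loewner_le n X Z"
  by (fastforce simp: loewner_le_iff)

lemma loewner_le_refl: "hermitian_mat n X \<Longrightarrow> loewner_le n X X"
  by (simp add: loewner_le_iff)

lemma loewner_le_add:
  "loewner_le n X Y \<Longrightarrow> loewner_le n X' Y' \<Longrightarrow> loewner_le n (X + X') (Y + Y')"
  by (auto simp: loewner_le_iff hermitian_add qform_add[of _ n] carrier_mat_hermitian intro: add_mono)

lemma loewner_le_congruence:
  assumes "loewner_le m X Y" and "Z \<in> carrier_mat m n"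
  shows "loewner_le n (Z\<^sup>H * X * Z) (Z\<^sup>H * Y * Z)"
  using assms
  by (auto simp: loewner_le_iff hermitian_congruence qform_congruence[of _ m] carrier_mat_hermitian)

lemma pos_def_add: "pos_def n X \<Longrightarrow> pos_def n Y \<Longrightarrow> pos_def n (X + Y)"
  by (auto simp: pos_def_iff hermitian_add qform_add[of _ n] carrier_mat_hermitian intro: add_pos_pos)

lemma pos_def_smult: "pos_def n X \<Longrightarrow> c > 0 \<Longrightarrow> pos_def n (complex_of_real c \<cdot>\<^sub>m X)"
  by (auto simp: pos_def_iff hermitian_smult qform_smult[of _ n] carrier_mat_hermitian)

text \<open>The left inverse \<open>Y\<close> makes \<open>Z\<close> injective, so the form of
  \<open>A\<close> is evaluated at a nonzero vector whenever \<open>x\<close> is nonzero.\<close>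

lemma pos_def_congruence:
  assumes "pos_def m A" "Z \<in> carrier_mat m n" "Y \<in> carrier_mat n m" "Y * Z = 1\<^sub>m n"
  shows "pos_def n (Z\<^sup>H * A * Z)"
proof -
  have "Z *\<^sub>v x \<noteq> 0\<^sub>v m" if "x \<in> carrier_vec n" "x \<noteq> 0\<^sub>v n" for x
  proof
    assume "Z *\<^sub>v x = 0\<^sub>v m"
    then have "Y *\<^sub>v (Z *\<^sub>v x) = Y *\<^sub>v 0\<^sub>v m" by simp
    moreover have "Y *\<^sub>v (Z *\<^sub>v x) = x"
      using assms(2-4) that by (simp flip: assoc_mult_mat_vec)
    moreover have "Y *\<^sub>v 0\<^sub>v m = 0\<^sub>v n"
      using assms(3) by (intro eq_vecI) auto
    ultimately show False using that by simp
  qed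
  then show ?thesis
    using assms by (auto simp: pos_def_iff hermitian_congruence qform_congruence[of _ m] carrier_mat_hermitian)
qed

lemma qform_unit_vec:
  assumes "A \<in> carrier_mat n n" "i < n"
  shows "qform A (unit_vec n i) = Re (A $$ (i, i))"
proof -
  have "conjugate (unit_vec n i) = (unit_vec n i :: complex vec)"
    by (intro eq_vecI) (auto simp: unit_vec_def)
  moreover have "A *\<^sub>v unit_vec n i = col A i"
    using assms by (intro eq_vecI) auto
  ultimately show ?thesis
    using assms by (simp add: qform_def)
qed

lemma pos_def_rdiag_iff: "pos_def n (rdiag n d) \<longleftrightarrow> (\<forall>i<n. d i > 0)"
proof
  assume *: "pos_def n (rdiag n d)"
  show "\<forall>i<n. d i > 0"
  proof (intro allI impI)
    fix i assume i: "i < n"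
    then have "qform (rdiag n d) (unit_vec n i) > 0"
      using * by (auto simp: pos_def_iff)
    then show "d i > 0"
      using i by (subst (asm) qform_unit_vec) (auto simp: mat_diag_def)
  qed
next
  assume d: "\<forall>i<n. d i > 0"
  show "pos_def n (rdiag n d)"
    unfolding pos_def_iff
  proof (intro conjI ballI impI)
    fix x :: "complex vec" assume x: "x \<in> carrier_vec n" "x \<noteq> 0\<^sub>v n"
    then obtain i where "i < n" "x $ i \<noteq> 0" by (metis carrier_vecD eq_vecI index_zero_vec)
    then show "qform (rdiag n d) x > 0"
      using d x by (auto simp: qform_rdiag intro!: sum_pos2[of _ i] mult_nonneg_nonneg simp: less_imp_le)
  qed (rule hermitian_rdiag)
qed

lemma loewner_le_rdiag: "(\<And>i. i < n \<Longrightarrow> d i \<le> e i) \<Longrightarrow> loewner_le n (rdiag n d) (rdiag n e)"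
  by (auto simp: loewner_le_iff hermitian_rdiag qform_rdiag intro!: sum_mono mult_right_mono)

section \<open>The spectral theorem\<close>

text \<open>Basis completion and Gram-Schmidt give an orthogonal family that starts with
  \<open>v\<close>; dividing each member by its norm yields the columns of a unitary matrix.\<close>

lemma unitary_with_first_col:
  assumes v: "v \<in> carrier_vec n" and v0: "v \<noteq> 0\<^sub>v n"
  obtains U :: "complex mat" and c where "U \<in> carrier_mat n n" "U\<^sup>H * U = 1\<^sub>m n" "col U 0 = c \<cdot>\<^sub>v v"
proof -
  interpret cof_vec_space n "TYPE(complex)" .
  define b where "b = basis_completion v"
  define ws where "ws = gram_schmidt n b"
  from basis_completion[OF v v0, folded b_def]
  have dist_b: "distinct b" and indep: "\<not> lin_dep (set b)" and b: "set b \<subseteq> carrier_vec n"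
    and hdb: "hd b = v" and len_b: "length b = n" by auto
  have n: "n \<noteq> 0" using v v0 by (metis carrier_vecD carrier_vec_dim_vec eq_vecI index_zero_vec(2) not_less_zero)
  with hdb len_b obtain vs where bv: "b = v # vs" by (cases b) auto
  from gram_schmidt_result[OF b dist_b indep refl, folded ws_def]
  have ws: "set ws \<subseteq> carrier_vec n" "corthogonal ws" "length ws = n"
    by (auto simp: len_b)
  have "hd ws = v" unfolding ws_def bv using v by simp
  then have ws0: "ws ! 0 = v" using ws(3) n by (cases ws) auto
  have wsc: "ws ! i \<in> carrier_vec n" if "i < n" for i
    using ws that by auto
  define c where "c i = sqrt (Re ((ws ! i) \<bullet>c (ws ! i)))" for i
  have pos: "(ws ! i) \<bullet>c (ws ! i) = complex_of_real (c i * c i)" "c i > 0" if i: "i < n" for i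
  proof -
    have "(ws ! i) \<bullet>c (ws ! i) \<noteq> 0"
      using corthogonalD[OF ws(2), of i i] i ws(3) by simp
    moreover have "(ws ! i) \<bullet>c (ws ! i) \<ge> 0" by (rule conjugate_square_ge_0_vec)
    ultimately have "Re ((ws ! i) \<bullet>c (ws ! i)) > 0" "Im ((ws ! i) \<bullet>c (ws ! i)) = 0"
      by (auto simp: less_eq_complex_def complex_eq_iff)
    then show "(ws ! i) \<bullet>c (ws ! i) = complex_of_real (c i * c i)" "c i > 0"
      by (auto simp: c_def complex_eq_iff)
  qed
  define U where "U = mat n n (\<lambda>(i, j). ws ! j $ i / complex_of_real (c j))"
  have "U\<^sup>H * U = 1\<^sub>m n"
  proof (rule eq_matI)
    fix i j assume "i < dim_row (1\<^sub>m n :: complex mat)" "j < dim_col (1\<^sub>m n :: complex mat)"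
    then have ij: "i < n" "j < n" by auto
    have "(U\<^sup>H * U) $$ (i, j) = (\<Sum>k<n. cnj (ws ! i $ k) / c i * (ws ! j $ k / c j))"
      using ij by (simp add: U_def scalar_prod_def atLeast0LessThan)
    also have "\<dots> = (\<Sum>k<n. ws ! j $ k * cnj (ws ! i $ k)) / (c i * c j)"
      by (simp add: sum_divide_distrib mult.commute)
    also have "(\<Sum>k<n. ws ! j $ k * cnj (ws ! i $ k)) = (ws ! j) \<bullet>c (ws ! i)"
      using wsc[OF ij(1)] wsc[OF ij(2)] by (simp add: scalar_prod_def atLeast0LessThan)
    also have "\<dots> / (c i * c j) = (if i = j then 1 else 0)"
    proof (cases "i = j")
      case True
      then show ?thesis using pos[OF ij(2)] by simp
    next
      case False
      then have "(ws ! j) \<bullet>c (ws ! i) = 0"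
        using corthogonalD[OF ws(2), of j i] ij ws(3) by auto
      then show ?thesis using False by simp
    qed
    finally show "(U\<^sup>H * U) $$ (i, j) = 1\<^sub>m n $$ (i, j)" using ij by simp
  qed (auto simp: U_def)
  moreover have "col U 0 = (1 / complex_of_real (c 0)) \<cdot>\<^sub>v v"
    using n v by (intro eq_vecI) (auto simp: U_def ws0)
  moreover have "U \<in> carrier_mat n n" by (simp add: U_def)
  ultimately show thesis using that by blast
qed

text \<open>The deflation step of the spectral theorem: self-adjointness turns the vanishing first
  column into a vanishing first row, so the corner entry splits off.\<close>

lemma four_block_mat_1x1:
  assumes M: "M \<in> carrier_mat (Suc n) (Suc n)" and h: "M\<^sup>H = M"
    and c: "\<And>i. 0 < i \<Longrightarrow> i < Suc n \<Longrightarrow> M $$ (i, 0) = (0 :: complex)"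
  shows "M = four_block_mat (mat 1 1 (\<lambda>_. M $$ (0, 0))) (0\<^sub>m 1 n) (0\<^sub>m n 1)
               (mat n n (\<lambda>(i, j). M $$ (Suc i, Suc j)))"
proof (rule eq_matI)
  have r: "M $$ (0, j) = 0" if "0 < j" "j < Suc n" for j
    using arg_cong[OF h, of "\<lambda>M. M $$ (0, j)"] that M c[OF that] by auto
  fix i j
  assume "i < dim_row (four_block_mat (mat 1 1 (\<lambda>_. M $$ (0, 0))) (0\<^sub>m 1 n) (0\<^sub>m n 1)
               (mat n n (\<lambda>(i, j). M $$ (Suc i, Suc j))))"
    "j < dim_col (four_block_mat (mat 1 1 (\<lambda>_. M $$ (0, 0))) (0\<^sub>m 1 n) (0\<^sub>m n 1)
               (mat n n (\<lambda>(i, j). M $$ (Suc i, Suc j))))"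
  then show "M $$ (i, j) = four_block_mat (mat 1 1 (\<lambda>_. M $$ (0, 0))) (0\<^sub>m 1 n) (0\<^sub>m n 1)
               (mat n n (\<lambda>(i, j). M $$ (Suc i, Suc j))) $$ (i, j)"
    using r c by (auto simp: index_mat_four_block)
qed (use M in auto)

lemma unitary_right_inverse:
  fixes U :: "complex mat"
  assumes "U \<in> carrier_mat n n" "U\<^sup>H * U = 1\<^sub>m n"
  shows "U * U\<^sup>H = 1\<^sub>m n"
  using mat_mult_left_right_inverse[OF _ _ assms(2)] assms(1) by simp

text \<open>Block diagonal matrices multiply and take adjoints blockwise, so two diagonalizations
  can be placed side by side. This serves both the deflation and the functional calculus of the
  dilation.\<close>

lemma unitary_diag_block:
  assumes "unitary_diag n A U d" "unitary_diag m B V e"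
  shows "unitary_diag (n + m) (four_block_mat A (0\<^sub>m n m) (0\<^sub>m m n) B)
    (four_block_mat U (0\<^sub>m n m) (0\<^sub>m m n) V) (\<lambda>i. if i < n then d i else e (i - n))"
proof -
  have c: "U \<in> carrier_mat n n" "V \<in> carrier_mat m m" "U\<^sup>H \<in> carrier_mat n n" "V\<^sup>H \<in> carrier_mat m m"
    using assms by (auto simp: unitary_diag_def intro: mat_adjoint_carrier)
  have z: "(0\<^sub>m n m)\<^sup>H = (0\<^sub>m m n :: complex mat)" for n m by (rule eq_matI) auto
  have D: "rdiag (n + m) (\<lambda>i. if i < n then d i else e (i - n)) =
    four_block_mat (rdiag n d) (0\<^sub>m n m) (0\<^sub>m m n) (rdiag m e)"
    by (rule eq_matI) (auto simp: mat_diag_def)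
  have adj: "(four_block_mat U (0\<^sub>m n m) (0\<^sub>m m n) V)\<^sup>H = four_block_mat (U\<^sup>H) (0\<^sub>m n m) (0\<^sub>m m n) (V\<^sup>H)"
    using c by (subst mat_adjoint_four_block[of _ n n _ m _ m]) (auto simp: z)
  have mult: "four_block_mat X (0\<^sub>m n m) (0\<^sub>m m n) Y * four_block_mat X' (0\<^sub>m n m) (0\<^sub>m m n) Y' =
     four_block_mat (X * X') (0\<^sub>m n m) (0\<^sub>m m n) (Y * Y')"
    if "X \<in> carrier_mat n n" "X' \<in> carrier_mat n n" "Y \<in> carrier_mat m m" "Y' \<in> carrier_mat m m"
    for X X' Y Y' :: "complex mat"
    using that by (subst mult_four_block_mat[of _ n n _ m _ m _ _ n _ m]) auto
  show ?thesis
    using assms c unfolding unitary_diag_def adj D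
    by (auto simp: mult four_block_one_mat mult_carrier_mat[where n = n] mult_carrier_mat[where n = m])
qed

lemma unitary_diag_conj:
  assumes "unitary_diag n (U\<^sup>H * A * U) V d" "U \<in> carrier_mat n n" "U\<^sup>H * U = 1\<^sub>m n" "A \<in> carrier_mat n n"
  shows "unitary_diag n A (U * V) d"
proof -
  have U: "U * U\<^sup>H = 1\<^sub>m n" using assms by (intro unitary_right_inverse)
  have V: "V \<in> carrier_mat n n" "V * V\<^sup>H = 1\<^sub>m n" "V\<^sup>H * V = 1\<^sub>m n"
    and e: "U\<^sup>H * A * U = V * rdiag n d * V\<^sup>H"
    using assms(1) by (auto simp: unitary_diag_def)
  \<comment> \<open>Dimensions are side conditions of the matrix laws; fixing every intermediate
    dimension to \<open>n\<close> lets the simplifier discharge them.\<close>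
  note c = V(1) assms(2,4) mat_adjoint_carrier[OF V(1)] mat_adjoint_carrier[OF assms(2)]
  note [simp] = c mult_carrier_mat[where n = n] assoc_mult_mat[where ?n\<^sub>1 = n and ?n\<^sub>2 = n and ?n\<^sub>3 = n and ?n\<^sub>4 = n]
    left_mult_one_mat[where nr = n and nc = n] right_mult_one_mat[where nr = n and nc = n]
  \<comment> \<open>Associativity nests products to the right, so each cancellation rule carries the
    remaining factor \<open>X\<close>.\<close>
  have cancel: "U * (U\<^sup>H * X) = X" "U\<^sup>H * (U * X) = X" "V * (V\<^sup>H * X) = X" "V\<^sup>H * (V * X) = X"
    if "X \<in> carrier_mat n n" for X
    using that U assms(3) V(2,3) by (simp_all flip: assoc_mult_mat[where ?n\<^sub>1 = n and ?n\<^sub>2 = n and ?n\<^sub>3 = n and ?n\<^sub>4 = n] del: assoc_mult_mat)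
  have "A = U * (U\<^sup>H * A * U) * U\<^sup>H"
    using U cancel by simp
  also have "\<dots> = U * V * rdiag n d * (U * V)\<^sup>H"
    unfolding e by (simp add: mat_adjoint_mult[of _ n n _ n])
  finally show ?thesis
    using cancel U V by (simp add: unitary_diag_def mat_adjoint_mult[of _ n n _ n] assms(3))
qed

text \<open>Induction on the size by deflation: an eigenvector is made the first column of a unitary
  matrix, conjugation by it splits off a block of size 1, and the induction hypothesis diagonalizes
  the rest.\<close>

theorem hermitian_unitary_diag:
  "hermitian_mat n A \<Longrightarrow> \<exists>U d. unitary_diag n A U d"
proof (induction n arbitrary: A)
  case 0
  then have "unitary_diag 0 A (1\<^sub>m 0) (\<lambda>_. 0)"
    by (auto simp: unitary_diag_def hermitian_mat_def intro!: eq_matI)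
  then show ?case by blast
next
  case (Suc n)
  then have A: "A \<in> carrier_mat (Suc n) (Suc n)" "A\<^sup>H = A" by (auto simp: hermitian_mat_def)
  obtain e where "eigenvalue A e"
    using spectrum_non_empty[OF A(1)] by (auto simp: spectrum_def)
  then obtain v where v: "v \<in> carrier_vec (Suc n)" "v \<noteq> 0\<^sub>v (Suc n)" "A *\<^sub>v v = e \<cdot>\<^sub>v v"
    using A by (auto simp: eigenvalue_def eigenvector_def)
  obtain U c where U: "U \<in> carrier_mat (Suc n) (Suc n)" "U\<^sup>H * U = 1\<^sub>m (Suc n)" "col U 0 = c \<cdot>\<^sub>v v"
    using unitary_with_first_col[OF v(1,2)] .
  define M where "M = U\<^sup>H * A * U"
  have hM: "hermitian_mat (Suc n) M"
    unfolding M_def by (rule hermitian_congruence[OF Suc.prems U(1)])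
  then have M: "M \<in> carrier_mat (Suc n) (Suc n)" "M\<^sup>H = M" by (auto simp: hermitian_mat_def)
  have AU: "col (A * U) 0 = e \<cdot>\<^sub>v col U 0"
  proof -
    have "col (A * U) 0 = A *\<^sub>v col U 0" using A U(1) by (intro eq_vecI) auto
    also have "\<dots> = c \<cdot>\<^sub>v (A *\<^sub>v v)" unfolding U(3) using A v(1) by (intro mult_mat_vec)
    finally show ?thesis using v by (simp add: U(3) smult_smult_assoc mult.commute)
  qed
  \<comment> \<open>The first column of \<open>M\<close> is \<open>U\<^sup>H\<close> applied to
    \<open>e\<close> times the first column of \<open>U\<close>, hence \<open>e\<close> times the
    first unit vector.\<close>
  have col: "M $$ (i, 0) = e * (if i = 0 then 1 else 0)" if i: "i < Suc n" for i
  proof -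
    have "M = U\<^sup>H * (A * U)" unfolding M_def using A U(1) by (simp add: assoc_mult_mat[of _ "Suc n" "Suc n" _ "Suc n"])
    then have "M $$ (i, 0) = row (U\<^sup>H) i \<bullet> col (A * U) 0"
      using i A U(1) by simp
    also have "\<dots> = e * (row (U\<^sup>H) i \<bullet> col U 0)"
      unfolding AU using U(1) i by (subst scalar_prod_smult_right) auto
    also have "row (U\<^sup>H) i \<bullet> col U 0 = (U\<^sup>H * U) $$ (i, 0)"
      using U(1) i by simp
    finally show ?thesis using i by (simp add: U(2))
  qed
  define M' where "M' = mat n n (\<lambda>(i, j). M $$ (Suc i, Suc j))"
  have Meq: "M = four_block_mat (mat 1 1 (\<lambda>_. M $$ (0, 0))) (0\<^sub>m 1 n) (0\<^sub>m n 1) M'"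
    unfolding M'_def by (rule four_block_mat_1x1) (use M col in auto)
  have Mh: "M $$ (i, j) = cnj (M $$ (j, i))" if "i < Suc n" "j < Suc n" for i j
    using arg_cong[OF M(2), of "\<lambda>M. M $$ (i, j)"] that M(1) by auto
  have "hermitian_mat n M'"
    unfolding hermitian_mat_def M'_def
    by (auto intro!: eq_matI simp: Mh[symmetric])
  then obtain V d where V: "unitary_diag n M' V d" using Suc.IH by blast
  \<comment> \<open>The corner entry equals its own conjugate, so it is real and can serve as an
    eigenvalue.\<close>
  have "unitary_diag 1 (mat 1 1 (\<lambda>_. M $$ (0, 0))) (1\<^sub>m 1) (\<lambda>_. Re (M $$ (0, 0)))"
    using Mh[of 0 0] by (auto simp: unitary_diag_def mat_diag_def complex_eq_iff scalar_prod_def intro!: eq_matI)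
  from unitary_diag_block[OF this V]
  obtain V' d' where "unitary_diag (Suc n) M V' d'" by (metis Meq plus_1_eq_Suc)
  then have "unitary_diag (Suc n) A (U * V') d'"
    using unitary_diag_conj U A unfolding M_def by blast
  then show ?case by blast
qed

lemma unitary_diagD:
  assumes "unitary_diag n A U d"
  shows "U \<in> carrier_mat n n" "U\<^sup>H \<in> carrier_mat n n" "U * U\<^sup>H = 1\<^sub>m n" "U\<^sup>H * U = 1\<^sub>m n"
    "A = U * rdiag n d * U\<^sup>H" "A \<in> carrier_mat n n"
  using assms by (auto simp: unitary_diag_def intro: mat_adjoint_carrier)

lemma unitary_diag_pos_def_iff:
  assumes "unitary_diag n A U d"
  shows "pos_def n A \<longleftrightarrow> (\<forall>i<n. d i > 0)"
proof
  note U = unitary_diagD[OF assms]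
  assume *: "pos_def n A"
  note [simp] = U(1,2) mult_carrier_mat[where n = n] assoc_mult_mat[where ?n\<^sub>1 = n and ?n\<^sub>2 = n and ?n\<^sub>3 = n and ?n\<^sub>4 = n]
    left_mult_one_mat[where nr = n and nc = n] right_mult_one_mat[where nr = n and nc = n]
  have cancel: "U\<^sup>H * (U * X) = X"
    if "X \<in> carrier_mat n n" for X
    using that U by (simp flip: assoc_mult_mat[where ?n\<^sub>1 = n and ?n\<^sub>2 = n and ?n\<^sub>3 = n and ?n\<^sub>4 = n] del: assoc_mult_mat)
  have "U\<^sup>H * A * U = rdiag n d"
    using U by (simp add: cancel)
  with pos_def_congruence[OF * U(1,2,4)] show "\<forall>i<n. d i > 0"
    by (simp add: pos_def_rdiag_iff)
next
  note U = unitary_diagD[OF assms]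
  assume "\<forall>i<n. d i > 0"
  then have "pos_def n ((U\<^sup>H)\<^sup>H * rdiag n d * U\<^sup>H)"
    using U by (intro pos_def_congruence[where Y = U]) (auto simp: pos_def_rdiag_iff)
  then show "pos_def n A" using U(5) by simp
qed

lemma pos_def_unitary_diag:
  assumes "pos_def n A"
  obtains U d where "unitary_diag n A U d" "\<And>i. i < n \<Longrightarrow> d i > 0"
  using hermitian_unitary_diag[OF pos_def_hermitian[OF assms]] unitary_diag_pos_def_iff assms by metis

section \<open>Functional calculus\<close>

text \<open>All functions of \<open>A\<close> share one diagonalizing unitary; compositions of
  functions are therefore computed on the eigenvalues.\<close>

lemma unitary_diag_mat_fun:
  assumes "unitary_diag n A U d"
  shows "unitary_diag n (mat_fun f A) U (\<lambda>i. f (d i))"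
  using assms unfolding mat_fun_eq[OF assms] by (simp add: unitary_diag_def)

lemma unitary_diag_hermitian:
  assumes "unitary_diag n A U d"
  shows "hermitian_mat n A"
proof -
  have "hermitian_mat n ((U\<^sup>H)\<^sup>H * rdiag n d * U\<^sup>H)"
    using unitary_diagD[OF assms] by (intro hermitian_congruence[of n] hermitian_rdiag)
  then show ?thesis using unitary_diagD(5)[OF assms] by simp
qed

lemma mat_fun_hermitian: "pos_def n A \<Longrightarrow> hermitian_mat n (mat_fun f A)"
  using hermitian_unitary_diag[OF pos_def_hermitian] unitary_diag_hermitian[OF unitary_diag_mat_fun] by blast

lemma mat_fun_adjoint: "pos_def n A \<Longrightarrow> (mat_fun f A)\<^sup>H = mat_fun f A"
  using mat_fun_hermitian by (auto simp: hermitian_mat_def)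

lemma mat_fun_carrier: "pos_def n A \<Longrightarrow> mat_fun f A \<in> carrier_mat n n"
  using mat_fun_hermitian by (auto simp: hermitian_mat_def)

lemma mat_fun_pos_def:
  assumes "pos_def n A" and "\<And>x. x > 0 \<Longrightarrow> f x > 0"
  shows "pos_def n (mat_fun f A)"
proof -
  obtain U d where U: "unitary_diag n A U d" "\<And>i. i < n \<Longrightarrow> d i > 0"
    using pos_def_unitary_diag[OF assms(1)] by blast
  show ?thesis
    using unitary_diag_pos_def_iff[OF unitary_diag_mat_fun[OF U(1)]] U(2) assms(2) by blast
qed

text \<open>The eigenvalues are positive, so identities valid only for positive arguments, such as
  \<open>sqrt x * (1 / sqrt x) = 1\<close>, may be used under the functional calculus.\<close>

lemma mat_fun_cong:
  assumes "pos_def n A" and "\<And>x. x > 0 \<Longrightarrow> f x = g x"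
  shows "mat_fun f A = mat_fun g A"
proof -
  obtain U d where U: "unitary_diag n A U d" "\<And>i. i < n \<Longrightarrow> d i > 0"
    using pos_def_unitary_diag[OF assms(1)] by blast
  have "rdiag n (\<lambda>i. f (d i)) = rdiag n (\<lambda>i. g (d i))"
    by (rule rdiag_cong) (use U assms in auto)
  then show ?thesis unfolding mat_fun_eq[OF U(1)] by simp
qed

lemma mat_fun_comp:
  assumes "pos_def n A"
  shows "mat_fun f (mat_fun g A) = mat_fun (\<lambda>x. f (g x)) A"
proof -
  obtain U d where U: "unitary_diag n A U d"
    using pos_def_unitary_diag[OF assms(1)] by blast
  show ?thesis
    using mat_fun_eq[OF unitary_diag_mat_fun[OF U, of g], of f] mat_fun_eq[OF U, of "\<lambda>x. f (g x)"]
    by simp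
qed

lemma mat_fun_id:
  assumes "pos_def n A"
  shows "mat_fun (\<lambda>x. x) A = A"
proof -
  obtain U d where U: "unitary_diag n A U d"
    using pos_def_unitary_diag[OF assms(1)] by blast
  show ?thesis unfolding mat_fun_eq[OF U] using unitary_diagD(5)[OF U] ..
qed

lemma mat_fun_const_one:
  assumes "pos_def n A"
  shows "mat_fun (\<lambda>x. 1) A = 1\<^sub>m n"
proof -
  obtain U d where U: "unitary_diag n A U d"
    using pos_def_unitary_diag[OF assms(1)] by blast
  show ?thesis unfolding mat_fun_eq[OF U] using unitary_diagD(1-4)[OF U] by simp
qed

lemma mat_fun_mult:
  assumes "pos_def n A"
  shows "mat_fun f A * mat_fun g A = mat_fun (\<lambda>x. f x * g x) A"
proof -
  obtain U d where U: "unitary_diag n A U d"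
    using pos_def_unitary_diag[OF assms(1)] by blast
  note U' = unitary_diagD[OF U]
  note a = assoc_mult_mat[where ?n\<^sub>1 = n and ?n\<^sub>2 = n and ?n\<^sub>3 = n and ?n\<^sub>4 = n]
  note [simp] = U'(1,2) mult_carrier_mat[where n = n] a
    left_mult_one_mat[where nr = n and nc = n] right_mult_one_mat[where nr = n and nc = n]
  have c: "U\<^sup>H * (U * X) = X" if "X \<in> carrier_mat n n" for X
    using that U' by (simp flip: a del: assoc_mult_mat)
  have d: "rdiag n (\<lambda>i. f (d i)) * (rdiag n (\<lambda>i. g (d i)) * X) = rdiag n (\<lambda>i. f (d i) * g (d i)) * X"
    if "X \<in> carrier_mat n n" for X
    using that by (simp flip: a del: assoc_mult_mat)
  show ?thesis unfolding mat_fun_eq[OF U] by (simp add: c d)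
qed

lemma mat_fun_sqrt:
  assumes "pos_def n A"
  defines "R \<equiv> mat_fun sqrt A" and "S \<equiv> mat_fun (\<lambda>t. 1 / sqrt t) A"
  shows "R \<in> carrier_mat n n" "S \<in> carrier_mat n n" "R\<^sup>H = R" "S\<^sup>H = S"
    "R * R = A" "R * S = 1\<^sub>m n" "S * R = 1\<^sub>m n"
proof -
  show "R \<in> carrier_mat n n" "S \<in> carrier_mat n n" "R\<^sup>H = R" "S\<^sup>H = S"
    using assms(1) by (simp_all add: R_def S_def mat_fun_carrier mat_fun_adjoint)
  have "R * R = mat_fun (\<lambda>x. x) A"
    unfolding R_def mat_fun_mult[OF assms(1)] by (rule mat_fun_cong[OF assms(1)]) simp
  then show "R * R = A" by (simp add: mat_fun_id[OF assms(1)])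
  have "R * S = mat_fun (\<lambda>x. 1) A"
    unfolding R_def S_def mat_fun_mult[OF assms(1)] by (rule mat_fun_cong[OF assms(1)]) simp
  then show "R * S = 1\<^sub>m n" by (simp add: mat_fun_const_one[OF assms(1)])
  have "S * R = mat_fun (\<lambda>x. 1) A"
    unfolding R_def S_def mat_fun_mult[OF assms(1)] by (rule mat_fun_cong[OF assms(1)]) simp
  then show "S * R = 1\<^sub>m n" by (simp add: mat_fun_const_one[OF assms(1)])
qed

lemma unitary_diag_rdiag: "unitary_diag n (rdiag n d) (1\<^sub>m n) d"
  by (simp add: unitary_diag_def left_mult_one_mat[of _ n n] right_mult_one_mat[of _ n n])

lemma mat_fun_rdiag: "mat_fun f (rdiag n d) = rdiag n (\<lambda>i. f (d i))"
  unfolding mat_fun_eq[OF unitary_diag_rdiag]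
  by (simp add: left_mult_one_mat[of _ n n] right_mult_one_mat[of _ n n])

lemma mat_fun_loewner_le:
  assumes "pos_def n A" and "\<And>x. x > 0 \<Longrightarrow> f x \<le> g x"
  shows "loewner_le n (mat_fun f A) (mat_fun g A)"
proof -
  obtain U d where U: "unitary_diag n A U d" "\<And>i. i < n \<Longrightarrow> d i > 0"
    using pos_def_unitary_diag[OF assms(1)] by blast
  have "loewner_le n ((U\<^sup>H)\<^sup>H * rdiag n (\<lambda>i. f (d i)) * U\<^sup>H) ((U\<^sup>H)\<^sup>H * rdiag n (\<lambda>i. g (d i)) * U\<^sup>H)"
    by (rule loewner_le_congruence[OF loewner_le_rdiag]) (use assms(2) U unitary_diagD[OF U(1)] in auto)
  then show ?thesis unfolding mat_fun_eq[OF U(1)] by simp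
qed

lemma mat_fun_smult:
  assumes "pos_def n A"
  shows "complex_of_real c \<cdot>\<^sub>m mat_fun f A = mat_fun (\<lambda>x. c * f x) A"
    and "mat_fun f (complex_of_real c \<cdot>\<^sub>m A) = mat_fun (\<lambda>x. f (c * x)) A"
proof -
  obtain U d where U: "unitary_diag n A U d"
    using pos_def_unitary_diag[OF assms(1)] by blast
  note U' = unitary_diagD[OF U]
  have *: "complex_of_real c \<cdot>\<^sub>m (U * rdiag n e * U\<^sup>H) = U * rdiag n (\<lambda>i. c * e i) * U\<^sup>H" for e
  proof -
    have "rdiag n (\<lambda>i. c * e i) = complex_of_real c \<cdot>\<^sub>m rdiag n e"
      by (rule eq_matI) (auto simp: mat_diag_def)
    then show ?thesis using U'
      by (simp add: mult_smult_distrib[of U n n _ n] mult_smult_assoc_mat[of _ n n _ n] mult_carrier_mat[where n = n])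
  qed
  show "complex_of_real c \<cdot>\<^sub>m mat_fun f A = mat_fun (\<lambda>x. c * f x) A"
    unfolding mat_fun_eq[OF U] by (rule *)
  have "unitary_diag n (complex_of_real c \<cdot>\<^sub>m A) U (\<lambda>i. c * d i)"
    using U *[of d] U'(5) by (simp add: unitary_diag_def)
  then show "mat_fun f (complex_of_real c \<cdot>\<^sub>m A) = mat_fun (\<lambda>x. f (c * x)) A"
    by (simp add: mat_fun_eq mat_fun_eq[OF U])
qed

section \<open>Operator means\<close>

text \<open>Let \<open>R\<close> and \<open>S\<close> be the square root of \<open>A\<close> and its
  inverse, and diagonalize \<open>S * B * S\<close> by \<open>U\<close>. Then
  \<open>Z = U\<^sup>H * R\<close> works, with inverse \<open>Y = S * U\<close>.\<close>

lemma simultaneous_congruence: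
  assumes "pos_def n A" "pos_def n B"
  obtains Z Y q where "Z \<in> carrier_mat n n" "Y \<in> carrier_mat n n" "Z * Y = 1\<^sub>m n" "Y * Z = 1\<^sub>m n"
    "A = Z\<^sup>H * Z" "B = Z\<^sup>H * rdiag n q * Z" "\<And>i. i < n \<Longrightarrow> q i > 0"
proof -
  define R where "R = mat_fun sqrt A"
  define S where "S = mat_fun (\<lambda>t. 1 / sqrt t) A"
  note RS = mat_fun_sqrt[OF assms(1), folded R_def S_def]
  have "pos_def n (S\<^sup>H * B * S)"
    by (rule pos_def_congruence[OF assms(2) RS(2,1,6)])
  then have "pos_def n (S * B * S)" by (simp add: RS)
  then obtain U d where U: "unitary_diag n (S * B * S) U d" "\<And>i. i < n \<Longrightarrow> d i > 0"
    using pos_def_unitary_diag by blast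
  note U' = unitary_diagD[OF U(1)]
  note a = assoc_mult_mat[where ?n\<^sub>1 = n and ?n\<^sub>2 = n and ?n\<^sub>3 = n and ?n\<^sub>4 = n]
  note [simp] = U'(1,2) RS(1-4) mult_carrier_mat[where n = n] a pos_def_carrier[OF assms(1)]
    pos_def_carrier[OF assms(2)] left_mult_one_mat[where nr = n and nc = n]
    right_mult_one_mat[where nr = n and nc = n] mat_adjoint_mult[where n = n and m = n and k = n]
  have cancel: "U * (U\<^sup>H * X) = X" "U\<^sup>H * (U * X) = X" "R * (S * X) = X" "S * (R * X) = X"
    if "X \<in> carrier_mat n n" for X
    using that U' RS by (simp_all flip: a del: assoc_mult_mat)
  show thesis
  proof
    show "U\<^sup>H * R \<in> carrier_mat n n" "S * U \<in> carrier_mat n n" by simp_all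
    show "U\<^sup>H * R * (S * U) = 1\<^sub>m n" "S * U * (U\<^sup>H * R) = 1\<^sub>m n"
      using U' RS by (simp_all add: cancel)
    show "A = (U\<^sup>H * R)\<^sup>H * (U\<^sup>H * R)" using RS by (simp add: cancel)
    have "(U\<^sup>H * R)\<^sup>H * rdiag n d * (U\<^sup>H * R) = R * (U * rdiag n d * U\<^sup>H) * R" by simp
    also have "\<dots> = R * (S * B * S) * R" by (simp only: U'(5))
    also have "\<dots> = B" using RS by (simp add: cancel)
    finally show "B = (U\<^sup>H * R)\<^sup>H * rdiag n d * (U\<^sup>H * R)" ..
    show "d i > 0" if "i < n" for i using U that by blast
  qed
qed

text \<open>The mean can be read off from any factorization \<open>Z\<^sup>H * Z\<close> of the
  first matrix, not only from its square root: the two factors differ by a unitary, which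
  cancels.\<close>

lemma op_mean_congruent_one:
  assumes "pos_def n (Z\<^sup>H * Z)" "Z \<in> carrier_mat n n"
  shows "op_mean f (Z\<^sup>H * Z) (Z\<^sup>H * rdiag n q * Z) = Z\<^sup>H * rdiag n (\<lambda>i. f (q i)) * Z"
proof -
  define A where "A = Z\<^sup>H * Z"
  define R where "R = mat_fun sqrt A"
  define S where "S = mat_fun (\<lambda>t. 1 / sqrt t) A"
  define U where "U = S * Z\<^sup>H"
  note RS = mat_fun_sqrt[OF assms(1), folded A_def, folded R_def S_def]
  note a = assoc_mult_mat[where ?n\<^sub>1 = n and ?n\<^sub>2 = n and ?n\<^sub>3 = n and ?n\<^sub>4 = n]
  note [simp] = RS(1-4) assms(2) mat_adjoint_carrier[OF assms(2)] mult_carrier_mat[where n = n] a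
    left_mult_one_mat[where nr = n and nc = n]
    right_mult_one_mat[where nr = n and nc = n] mat_adjoint_mult[where n = n and m = n and k = n]
  have cancel: "R * (S * X) = X" "S * (R * X) = X"
    if "X \<in> carrier_mat n n" for X
    using that RS by (simp_all flip: a del: assoc_mult_mat)
  have [simp]: "U \<in> carrier_mat n n" "U\<^sup>H \<in> carrier_mat n n" by (simp_all add: U_def)
  have UU: "U * U\<^sup>H = 1\<^sub>m n"
  proof -
    have "U * U\<^sup>H = S * (Z\<^sup>H * Z) * S" by (simp add: U_def)
    also have "\<dots> = S * (R * R) * S" using RS(5) by (simp add: A_def)
    finally show ?thesis using RS(6,7) by (simp add: cancel)
  qed
  \<comment> \<open>\<open>S * Z\<^sup>H\<close> is the unitary that diagonalizes the matrix to
    which \<open>op_mean\<close> applies \<open>f\<close>, and its eigenvalues are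
    \<open>q\<close>.\<close>
  have "unitary_diag n (S * (Z\<^sup>H * rdiag n q * Z) * S) U q"
    using UU mat_mult_left_right_inverse[OF _ _ UU] by (simp add: unitary_diag_def U_def)
  then have "op_mean f A (Z\<^sup>H * rdiag n q * Z) = R * (U * rdiag n (\<lambda>i. f (q i)) * U\<^sup>H) * R"
    by (simp add: op_mean_def Let_def mat_fun_eq flip: R_def S_def)
  also have "\<dots> = Z\<^sup>H * rdiag n (\<lambda>i. f (q i)) * Z"
    using RS by (simp add: U_def cancel)
  finally show ?thesis by (simp add: A_def)
qed

text \<open>Absorbing \<open>sqrt (p i)\<close> into the congruence turns the first diagonal into
  the identity and the second into the quotients \<open>q i / p i\<close>.\<close>

lemma op_mean_congruent_rdiag:
  assumes "pos_def n (Z\<^sup>H * rdiag n p * Z)" "Z \<in> carrier_mat n n" "\<And>i. i < n \<Longrightarrow> p i > 0"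
  shows "op_mean f (Z\<^sup>H * rdiag n p * Z) (Z\<^sup>H * rdiag n q * Z)
     = Z\<^sup>H * rdiag n (\<lambda>i. p i * f (q i / p i)) * Z"
proof -
  define X where "X = rdiag n (\<lambda>i. sqrt (p i)) * Z"
  note a = assoc_mult_mat[where ?n\<^sub>1 = n and ?n\<^sub>2 = n and ?n\<^sub>3 = n and ?n\<^sub>4 = n]
  note [simp] = assms(2) mat_adjoint_carrier[OF assms(2)] mult_carrier_mat[where n = n] a
    mat_adjoint_mult[where n = n and m = n and k = n]
  have X: "X\<^sup>H * rdiag n e * X = Z\<^sup>H * rdiag n (\<lambda>i. p i * e i) * Z" for e
  proof -
    have "X\<^sup>H * rdiag n e * X = Z\<^sup>H * (rdiag n (\<lambda>i. sqrt (p i)) * rdiag n e * rdiag n (\<lambda>i. sqrt (p i))) * Z"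
      by (simp add: X_def del: mat_diag_diag)
    also have "rdiag n (\<lambda>i. sqrt (p i)) * rdiag n e * rdiag n (\<lambda>i. sqrt (p i)) = rdiag n (\<lambda>i. p i * e i)"
    proof -
      have "sqrt (p i) * e i * sqrt (p i) = p i * e i" if "i < n" for i
        using assms(3)[OF that] by (simp add: mult.commute mult.left_commute)
      then show ?thesis by (auto intro!: rdiag_cong simp flip: of_real_mult)
    qed
    finally show ?thesis .
  qed
  have "X \<in> carrier_mat n n" by (simp add: X_def)
  then have 1: "X\<^sup>H * X = Z\<^sup>H * rdiag n p * Z"
    using X[of "\<lambda>_. 1"] by (simp add: right_mult_one_mat[where nr = n and nc = n])
  have "Z\<^sup>H * rdiag n q * Z = X\<^sup>H * rdiag n (\<lambda>i. q i / p i) * X"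
  proof -
    have "rdiag n q = rdiag n (\<lambda>i. p i * (q i / p i))"
    proof (rule rdiag_cong)
      fix i assume "i < n"
      then show "q i = p i * (q i / p i)" using assms(3)[of i] by simp
    qed
    then show ?thesis unfolding X by simp
  qed
  then show ?thesis
    using op_mean_congruent_one[of n X f "\<lambda>i. q i / p i"] assms(1) \<open>X \<in> carrier_mat n n\<close>
    unfolding 1 X by simp
qed

lemma op_mean_carrier:
  assumes "pos_def n A" "pos_def n B"
  shows "op_mean f A B \<in> carrier_mat n n"
proof -
  obtain Z Y q where Z: "Z \<in> carrier_mat n n" "A = Z\<^sup>H * Z" "B = Z\<^sup>H * rdiag n q * Z"
    using simultaneous_congruence[OF assms] by metis
  show ?thesis
    using op_mean_congruent_one[of n Z f q] assms(1) Z mat_adjoint_carrier[OF Z(1)]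
    by (simp add: mult_carrier_mat[where n = n])
qed

lemma op_mean_pos_def:
  assumes "pos_def n A" "pos_def n B" "\<And>x. x > 0 \<Longrightarrow> f x > 0"
  shows "pos_def n (op_mean f A B)"
proof -
  obtain Z Y q where Z: "Z \<in> carrier_mat n n" "Y \<in> carrier_mat n n" "Z * Y = 1\<^sub>m n" "Y * Z = 1\<^sub>m n"
    "A = Z\<^sup>H * Z" "B = Z\<^sup>H * rdiag n q * Z" "\<And>i. i < n \<Longrightarrow> q i > 0"
    using simultaneous_congruence[OF assms(1,2)] by blast
  have "pos_def n (Z\<^sup>H * rdiag n (\<lambda>i. f (q i)) * Z)"
    using Z assms(3) by (intro pos_def_congruence[of n _ Z n Y]) (auto simp: pos_def_rdiag_iff)
  then show ?thesis
    using op_mean_congruent_one[of n Z f q] assms Z by simp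
qed

lemma congruence_mult:
  fixes A Z W :: "complex mat"
  assumes "A \<in> carrier_mat n n" "Z \<in> carrier_mat n n" "W \<in> carrier_mat n n"
  shows "W\<^sup>H * (Z\<^sup>H * A * Z) * W = (Z * W)\<^sup>H * A * (Z * W)"
  using assms mat_adjoint_carrier[OF assms(2)] mat_adjoint_carrier[OF assms(3)]
  by (simp add: mat_adjoint_mult[where n = n and m = n and k = n] mult_carrier_mat[where n = n]
      assoc_mult_mat[where ?n\<^sub>1 = n and ?n\<^sub>2 = n and ?n\<^sub>3 = n and ?n\<^sub>4 = n])

text \<open>If \<open>Z\<close> diagonalizes the pair, then \<open>Z * W\<close> diagonalizes the
  transformed pair with the same \<open>q\<close>.\<close>

lemma op_mean_congruence:
  assumes "pos_def n A" "pos_def n B" "W \<in> carrier_mat n n" "V \<in> carrier_mat n n" "V * W = 1\<^sub>m n"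
  shows "op_mean f (W\<^sup>H * A * W) (W\<^sup>H * B * W) = W\<^sup>H * op_mean f A B * W"
proof -
  obtain Z Y q where Z: "Z \<in> carrier_mat n n" "Y \<in> carrier_mat n n" "Z * Y = 1\<^sub>m n" "Y * Z = 1\<^sub>m n"
    "A = Z\<^sup>H * Z" "B = Z\<^sup>H * rdiag n q * Z" "\<And>i. i < n \<Longrightarrow> q i > 0"
    using simultaneous_congruence[OF assms(1,2)] by blast
  have A: "Z\<^sup>H * Z = Z\<^sup>H * 1\<^sub>m n * Z" using Z(1) by simp
  have one: "W\<^sup>H * A * W = (Z * W)\<^sup>H * (Z * W)"
    unfolding Z(5) A using Z(1) assms(3) congruence_mult[of "1\<^sub>m n" n Z W]
      right_mult_one_mat[of "(Z * W)\<^sup>H" n n] by simp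
  have "pos_def n (W\<^sup>H * A * W)"
    by (rule pos_def_congruence[OF assms(1,3,4,5)])
  then have "op_mean f (W\<^sup>H * A * W) (W\<^sup>H * B * W) = (Z * W)\<^sup>H * rdiag n (\<lambda>i. f (q i)) * (Z * W)"
    unfolding one Z(6) congruence_mult[OF mat_diag_dim Z(1) assms(3)]
    by (rule op_mean_congruent_one) (use Z(1) assms(3) in \<open>simp_all add: mult_carrier_mat[where n = n]\<close>)
  also have "\<dots> = W\<^sup>H * op_mean f A B * W"
    using assms(1) Z by (simp add: op_mean_congruent_one congruence_mult[OF _ Z(1) assms(3)] del: assoc_mult_mat)
  finally show ?thesis .
qed

text \<open>Seen from \<open>B\<close>, the diagonal quotients are \<open>1 / q i\<close>; the
  factor \<open>q i\<close> coming from \<open>B\<close> cancels the factor \<open>x\<close> of the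
  transposed function.\<close>

lemma op_mean_transpose:
  assumes "pos_def n A" "pos_def n B"
  shows "op_mean f A B = op_mean (\<lambda>x. x * f (1 / x)) B A"
proof -
  obtain Z Y q where Z: "Z \<in> carrier_mat n n" "Y \<in> carrier_mat n n" "Z * Y = 1\<^sub>m n" "Y * Z = 1\<^sub>m n"
    "A = Z\<^sup>H * Z" "B = Z\<^sup>H * rdiag n q * Z" "\<And>i. i < n \<Longrightarrow> q i > 0"
    using simultaneous_congruence[OF assms(1,2)] by blast
  have A: "A = Z\<^sup>H * rdiag n (\<lambda>_. 1) * Z" using Z(1,5) by simp
  have "op_mean (\<lambda>x. x * f (1 / x)) B A = Z\<^sup>H * rdiag n (\<lambda>i. q i * (1 / q i * f (1 / (1 / q i)))) * Z"
    unfolding A Z(6) by (rule op_mean_congruent_rdiag) (use assms Z in auto)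
  also have "rdiag n (\<lambda>i. q i * (1 / q i * f (1 / (1 / q i)))) = rdiag n (\<lambda>i. f (q i))"
    by (rule rdiag_cong) (use Z(7) in \<open>simp add: less_imp_neq[symmetric]\<close>)
  finally show ?thesis
    using assms(1) Z by (simp add: op_mean_congruent_one)
qed

lemma op_mean_cong:
  assumes "pos_def n A" "pos_def n B" "\<And>x. x > 0 \<Longrightarrow> f x = g x"
  shows "op_mean f A B = op_mean g A B"
proof -
  obtain Z Y q where Z: "Z \<in> carrier_mat n n" "Y \<in> carrier_mat n n" "Z * Y = 1\<^sub>m n" "Y * Z = 1\<^sub>m n"
    "A = Z\<^sup>H * Z" "B = Z\<^sup>H * rdiag n q * Z" "\<And>i. i < n \<Longrightarrow> q i > 0"
    using simultaneous_congruence[OF assms(1,2)] by blast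
  have "rdiag n (\<lambda>i. f (q i)) = rdiag n (\<lambda>i. g (q i))"
    by (rule rdiag_cong) (use Z(7) assms(3) in auto)
  then show ?thesis
    using assms(1) Z by (simp add: op_mean_congruent_one)
qed

section \<open>Operator monotonicity of the square root\<close>

text \<open>With \<open>H = \<surd>Y - \<surd>X\<close> one has \<open>Y - X = \<surd>Y H + H \<surd>X\<close>, so at an eigenvector of \<open>H\<close> the form of
  \<open>Y - X\<close> has the sign of the eigenvalue.\<close>

lemma operator_monotone_sqrt: "operator_monotone sqrt"
  unfolding operator_monotone_def
proof (intro allI impI, elim conjE)
  fix n X Y assume X: "pos_def n X" and Y: "pos_def n Y" and XY: "loewner_le n X Y"
  define P where "P = mat_fun sqrt X"
  define Q where "Q = mat_fun sqrt Y"
  define H where "H = Q - P"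
  have P: "pos_def n P" "P * P = X" and Q: "pos_def n Q" "Q * Q = Y"
    unfolding P_def Q_def using X Y mat_fun_sqrt(5) by (auto intro!: mat_fun_pos_def)
  note [simp] = P(1)[THEN pos_def_carrier] Q(1)[THEN pos_def_carrier]
  have hH: "hermitian_mat n H"
    unfolding H_def using P Q by (intro hermitian_minus pos_def_hermitian)
  note [simp] = carrier_mat_hermitian[OF hH]
  obtain U d where U: "unitary_diag n H U d" using hermitian_unitary_diag[OF hH] by blast
  note U' = unitary_diagD[OF U]
  have "d i \<ge> 0" if i: "i < n" for i
  proof (rule ccontr)
    assume neg: "\<not> d i \<ge> 0"
    define v where "v = U *\<^sub>v unit_vec n i"
    have v: "v \<in> carrier_vec n" using U'(1) by (simp add: v_def)
    have Uv: "U\<^sup>H *\<^sub>v v = unit_vec n i"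
      using assoc_mult_mat_vec[OF U'(2,1) unit_vec_carrier[of n i]] U'(4)
      by (simp add: v_def)
    have v0: "v \<noteq> 0\<^sub>v n"
    proof
      assume "v = 0\<^sub>v n"
      moreover have "X *\<^sub>v 0\<^sub>v n = 0\<^sub>v n" if "X \<in> carrier_mat n n" for X :: "complex mat"
        using that by (intro eq_vecI) auto
      ultimately have "U\<^sup>H *\<^sub>v v = 0\<^sub>v n" using U'(2) by simp
      then have "unit_vec n i $ i = (0\<^sub>v n :: complex vec) $ i" using Uv by metis
      then show False using i by simp
    qed
    have Hv: "H *\<^sub>v v = complex_of_real (d i) \<cdot>\<^sub>v v"
    proof -
      have "H *\<^sub>v v = U *\<^sub>v (rdiag n d *\<^sub>v (U\<^sup>H *\<^sub>v v))"
        using U'(1,2) v mult_mat_vec_carrier[OF U'(2) v] unfolding U'(5)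
        by (simp add: assoc_mult_mat_vec[where ?n\<^sub>1 = n and ?n\<^sub>2 = n and ?n\<^sub>3 = n] mult_carrier_mat[where n = n])
      also have "rdiag n d *\<^sub>v (U\<^sup>H *\<^sub>v v) = complex_of_real (d i) \<cdot>\<^sub>v unit_vec n i"
        unfolding Uv using i by (intro eq_vecI) (auto simp: mat_diag_def)
      finally show ?thesis using U'(1) by (simp add: v_def mult_mat_vec[of _ n n])
    qed
    have telescope: "A - C = (A - B) + (B - C)"
      if "A \<in> carrier_mat n n" "B \<in> carrier_mat n n" "C \<in> carrier_mat n n" for A B C :: "complex mat"
      using that by (intro eq_matI) auto
    have YX: "Y - X = Q * H + H * P"
      unfolding H_def P(2)[symmetric] Q(2)[symmetric]
      by (simp add: mult_minus_distrib_mat[of _ n n _ n] minus_mult_distrib_mat[of _ n n _ _ n]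
          telescope[of "Q * Q" "Q * P" "P * P"] mult_carrier_mat[where n = n])
    have c: "Q * H \<in> carrier_mat n n" "H * P \<in> carrier_mat n n"
      by (auto intro!: mult_carrier_mat[where n = n])
    have "qform (Q * H) v = d i * qform Q v"
      using v by (simp add: qform_def Hv assoc_mult_mat_vec[where ?n\<^sub>1 = n and ?n\<^sub>2 = n and ?n\<^sub>3 = n]
          mult_mat_vec[of _ n n] smult_scalar_prod_distrib[of _ n] mult_mat_vec_carrier[of _ n n])
    \<comment> \<open>Here \<open>H\<close> stands on the left of the product. Being Hermitian it
      moves to the second argument of the inner product, and the real eigenvalue passes through the
      conjugation.\<close>
    moreover have "qform (H * P) v = d i * qform P v"
    proof -
      have "(H * P *\<^sub>v v) \<bullet>c v = (P *\<^sub>v v) \<bullet>c (H\<^sup>H *\<^sub>v v)"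
        using v by (simp add: assoc_mult_mat_vec[where ?n\<^sub>1 = n and ?n\<^sub>2 = n and ?n\<^sub>3 = n] adjoint_cscalar_prod[of H n n] mult_mat_vec_carrier[of _ n n])
      also have "H\<^sup>H = H" using hH by (simp add: hermitian_mat_def)
      finally show ?thesis
        using v by (simp add: qform_def Hv conjugate_smult_vec scalar_prod_smult_distrib[of _ n]
            mult_mat_vec_carrier[of _ n n])
    qed
    ultimately have "qform (Y - X) v = d i * (qform Q v + qform P v)"
      unfolding YX qform_add[OF c v] by (simp add: algebra_simps)
    moreover have "qform Q v > 0" "qform P v > 0"
      using P Q v v0 by (auto simp: pos_def_iff)
    ultimately have "qform (Y - X) v < 0" using neg by (simp add: mult_neg_pos)
    moreover have "qform (Y - X) v \<ge> 0"
      using XY v by (auto simp: loewner_le_def pos_semidef_iff)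
    ultimately show False by simp
  qed
  then have nonneg: "qform (rdiag n d) y \<ge> 0" if "y \<in> carrier_vec n" for y
    using that by (auto simp: qform_rdiag intro!: sum_nonneg)
  have "qform H x \<ge> 0" if x: "x \<in> carrier_vec n" for x
    using qform_congruence[OF mat_diag_dim U'(2) x, of "\<lambda>i. complex_of_real (d i)"]
      nonneg[OF mult_mat_vec_carrier[OF U'(2) x]] by (simp add: U'(5))
  then show "loewner_le n (mat_fun sqrt X) (mat_fun sqrt Y)"
    unfolding loewner_le_def pos_semidef_iff P_def[symmetric] Q_def[symmetric] H_def[symmetric]
    using P Q hH by (auto intro: pos_def_hermitian)
qed

section \<open>Jensen's inequality for operator monotone functions\<close>

abbreviation block_diag :: "nat \<Rightarrow> complex mat \<Rightarrow> complex mat \<Rightarrow> complex mat" where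
  "block_diag n A B \<equiv> four_block_mat A (0\<^sub>m n n) (0\<^sub>m n n) B"

lemma block_diag_pos_def_mat_fun:
  assumes "pos_def n A" "pos_def n B"
  shows "pos_def (n + n) (block_diag n A B)"
    and "mat_fun f (block_diag n A B) = block_diag n (mat_fun f A) (mat_fun f B)"
proof -
  obtain U d where U: "unitary_diag n A U d" "\<And>i. i < n \<Longrightarrow> d i > 0"
    using pos_def_unitary_diag[OF assms(1)] by blast
  obtain V e where V: "unitary_diag n B V e" "\<And>i. i < n \<Longrightarrow> e i > 0"
    using pos_def_unitary_diag[OF assms(2)] by blast
  note UV = unitary_diag_block[OF U(1) V(1)]
  show "pos_def (n + n) (block_diag n A B)"
    unfolding unitary_diag_pos_def_iff[OF UV] using U(2) V(2) by auto
  have eq: "rdiag (n + n) (\<lambda>i. if i < n then f (d i) else f (e (i - n))) =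
      rdiag (n + n) (\<lambda>i. f (if i < n then d i else e (i - n)))"
    by (rule rdiag_cong) simp
  show "mat_fun f (block_diag n A B) = block_diag n (mat_fun f A) (mat_fun f B)"
    unfolding mat_fun_eq[OF UV]
    using unitary_diagD(5)[OF unitary_diag_block[OF unitary_diag_mat_fun[OF U(1), of f] unitary_diag_mat_fun[OF V(1), of f]]]
    unfolding eq by simp
qed

lemma mat_fun_unitary_conj:
  assumes "pos_def n A" "W \<in> carrier_mat n n" "W\<^sup>H * W = 1\<^sub>m n"
  shows "pos_def n (W\<^sup>H * A * W)" and "mat_fun f (W\<^sup>H * A * W) = W\<^sup>H * mat_fun f A * W"
proof -
  show "pos_def n (W\<^sup>H * A * W)"
    using assms by (intro pos_def_congruence[of n A W n "W\<^sup>H"]) auto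
  obtain U d where U: "unitary_diag n A U d"
    using pos_def_unitary_diag[OF assms(1)] by blast
  note U' = unitary_diagD[OF U]
  have WW: "W * W\<^sup>H = 1\<^sub>m n" using unitary_right_inverse[OF assms(2,3)] .
  note a = assoc_mult_mat[where ?n\<^sub>1 = n and ?n\<^sub>2 = n and ?n\<^sub>3 = n and ?n\<^sub>4 = n]
  note [simp] = U'(1,2) assms(2) mult_carrier_mat[where n = n] a
    left_mult_one_mat[where nr = n and nc = n]
    right_mult_one_mat[where nr = n and nc = n] mat_adjoint_mult[where n = n and m = n and k = n]
  have cancel: "U * (U\<^sup>H * X) = X" "W * (W\<^sup>H * X) = X" "W\<^sup>H * (W * X) = X" "U\<^sup>H * (U * X) = X"
    if "X \<in> carrier_mat n n" for X
    using that U'(3,4) WW assms(3) by (simp_all flip: a del: assoc_mult_mat)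
  have "unitary_diag n (W\<^sup>H * A * W) (W\<^sup>H * U) d"
    unfolding U'(5) unitary_diag_def
    using U'(3,4) WW assms(3) by (simp add: cancel)
  then show "mat_fun f (W\<^sup>H * A * W) = W\<^sup>H * mat_fun f A * W"
    by (simp add: mat_fun_eq mat_fun_eq[OF U])
qed

text \<open>Vectors whose lower half is zero see only the upper left block.\<close>

lemma loewner_le_corner:
  assumes "loewner_le (n + n) (four_block_mat A B C D) (four_block_mat A' B' C' D')"
    and c: "A \<in> carrier_mat n n" "B \<in> carrier_mat n n" "C \<in> carrier_mat n n" "D \<in> carrier_mat n n"
      "A' \<in> carrier_mat n n" "B' \<in> carrier_mat n n" "C' \<in> carrier_mat n n" "D' \<in> carrier_mat n n"
    and h: "hermitian_mat n A" "hermitian_mat n A'"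
  shows "loewner_le n A A'"
  unfolding loewner_le_iff
proof (intro conjI ballI h)
  fix x :: "complex vec" assume x: "x \<in> carrier_vec n"
  have *: "qform (four_block_mat X Y Z W) (x @\<^sub>v 0\<^sub>v n) = qform X x"
    if "X \<in> carrier_mat n n" "Y \<in> carrier_mat n n" "Z \<in> carrier_mat n n" "W \<in> carrier_mat n n"
    for X Y Z W
  proof -
    have z: "M *\<^sub>v 0\<^sub>v n = 0\<^sub>v n" if "M \<in> carrier_mat n n" for M :: "complex mat"
      using that by (intro eq_vecI) auto
    have conj: "conjugate (x @\<^sub>v 0\<^sub>v n) = conjugate x @\<^sub>v 0\<^sub>v n"
      using x by (intro eq_vecI) auto
    have "four_block_mat X Y Z W *\<^sub>v (x @\<^sub>v 0\<^sub>v n) = (X *\<^sub>v x) @\<^sub>v (Z *\<^sub>v x)"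
      using that x by (subst four_block_mat_mult_vec[of _ n n _ n _ n])
        (simp_all add: z right_zero_vec[of _ n] mult_mat_vec_carrier[of _ n n])
    then show ?thesis
      using that x unfolding qform_def conj
      by (simp add: scalar_prod_append[of _ n _ n] mult_mat_vec_carrier[of _ n n])
  qed
  have "x @\<^sub>v 0\<^sub>v n \<in> carrier_vec (n + n)" using x by simp
  then show "qform A x \<le> qform A' x"
    using assms(1) c by (auto simp: loewner_le_iff *)
qed

text \<open>\<open>J * M * J\<close> is a congruence of \<open>M\<close> by a Hermitian matrix,
  hence positive semidefinite.\<close>

lemma loewner_le_add_congruence:
  assumes "pos_def n M" "J \<in> carrier_mat n n" "J\<^sup>H = J" "N = M + J * M * J"
  shows "pos_def n N" "loewner_le n M N"
proof -
  have h: "hermitian_mat n (J * M * J)"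
    using hermitian_congruence[OF pos_def_hermitian[OF assms(1)] assms(2)] assms(3) by simp
  have c: "M \<in> carrier_mat n n" "J * M * J \<in> carrier_mat n n"
    using pos_def_carrier[OF assms(1)] carrier_mat_hermitian[OF h] by auto
  have "qform (J * M * J) x \<ge> 0" if x: "x \<in> carrier_vec n" for x
  proof -
    have "qform M (J *\<^sub>v x) \<ge> 0"
    proof (cases "J *\<^sub>v x = 0\<^sub>v n")
      case True
      then show ?thesis
        using mult_mat_vec_carrier[OF c(1) zero_carrier_vec] by (simp add: qform_def)
    next
      case False
      then show ?thesis
        using assms(1) mult_mat_vec_carrier[OF assms(2) x] by (auto simp: pos_def_iff intro: less_imp_le)
    qed
    then show ?thesis using qform_congruence[OF c(1) assms(2) x] assms(3) by simp
  qed
  then show "pos_def n N" "loewner_le n M N"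
    using assms(1) h unfolding assms(4) pos_def_iff loewner_le_iff
    by (auto simp: hermitian_add qform_add[OF c] intro: add_pos_nonneg)
qed

text \<open>\<open>M\<close> is the unitary conjugate of \<open>block_diag C1 C2\<close> by the rotation \<open>W\<close>, and \<open>P\<close>, \<open>R\<close> are its
  diagonal blocks; adding \<open>J M J\<close> cancels the off-diagonal blocks.\<close>

lemma jensen_dilated:
  assumes f: "operator_monotone f" and q: "\<And>i. i < n \<Longrightarrow> 0 < q i \<and> q i < 1"
    and C: "pos_def n C1" "pos_def n C2" and eps: "\<epsilon> > 0"
  defines "c \<equiv> rdiag n (\<lambda>i. sqrt (q i))" and "s \<equiv> rdiag n (\<lambda>i. sqrt (1 - q i))"
  shows "pos_def n (c * C1 * c + s * C2 * s)"
    and "loewner_le n (c * mat_fun f C1 * c + s * mat_fun f C2 * s)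
      (mat_fun f (complex_of_real (1 + \<epsilon>) \<cdot>\<^sub>m (c * C1 * c + s * C2 * s)))"
proof -
  \<comment> \<open>The entry \<open>- s\<close> of the rotation, kept as a diagonal matrix of its
    own so that the product and adjoint rules for \<open>rdiag\<close> apply to it.\<close>
  define t where "t = rdiag n (\<lambda>i. - sqrt (1 - q i))"
  \<comment> \<open>\<open>ci\<close> and \<open>si\<close> are the inverses of \<open>c\<close> and
    \<open>s\<close>, available because \<open>0 < q i < 1\<close>; they are the left inverses that
    \<open>pos_def_congruence\<close> asks for.\<close>
  define ci where "ci = rdiag n (\<lambda>i. 1 / sqrt (q i))"
  define si where "si = rdiag n (\<lambda>i. 1 / sqrt (1 - q i))"
  have car [simp]: "c \<in> carrier_mat n n" "s \<in> carrier_mat n n" "t \<in> carrier_mat n n"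
    "ci \<in> carrier_mat n n" "si \<in> carrier_mat n n"
    by (simp_all add: c_def s_def t_def ci_def si_def)
  have adj: "c\<^sup>H = c" "s\<^sup>H = s" "t\<^sup>H = t"
    by (simp_all only: c_def s_def t_def mat_adjoint_rdiag)
  have inv: "ci * c = 1\<^sub>m n" "si * s = 1\<^sub>m n"
    unfolding ci_def c_def si_def s_def mat_diag_diag of_real_mult[symmetric]
    by (subst rdiag_one[symmetric], rule rdiag_cong, use q in force)+
  have pos: "pos_def n (c * D1 * c + s * D2 * s)" if "pos_def n D1" "pos_def n D2" for D1 D2
    using pos_def_congruence[OF that(1) car(1,4) inv(1)] pos_def_congruence[OF that(2) car(2,5) inv(2)]
    by (simp add: adj pos_def_add)
  have pos': "pos_def n (t * D1 * t + c * D2 * c)" if "pos_def n D1" "pos_def n D2" for D1 D2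
  proof -
    have ti: "rdiag n (\<lambda>i. - 1 / sqrt (1 - q i)) * t = 1\<^sub>m n"
      unfolding t_def mat_diag_diag of_real_mult[symmetric]
      by (subst rdiag_one[symmetric], rule rdiag_cong, use q in force)
    from pos_def_congruence[OF that(1) car(3) mat_diag_dim ti] pos_def_congruence[OF that(2) car(1,4) inv(1)]
    show ?thesis by (simp add: adj pos_def_add)
  qed
  define W where "W = four_block_mat c t s c"
  have W: "W \<in> carrier_mat (n + n) (n + n)" unfolding W_def by (rule four_block_carrier_mat) simp_all
  have WH: "W\<^sup>H = four_block_mat c s t c"
    unfolding W_def by (simp add: mat_adjoint_four_block[of _ n n _ n _ n] adj)
  have WW: "W\<^sup>H * W = 1\<^sub>m (n + n)"
  proof -
    have "W\<^sup>H * W = four_block_mat (c * c + s * s) (c * t + s * c) (t * c + c * s) (t * t + c * c)"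
      unfolding WH by (simp add: W_def mult_four_block_mat[of _ n n _ n _ n _ _ n _ n])
    also have "\<dots> = four_block_mat (1\<^sub>m n) (0\<^sub>m n n) (0\<^sub>m n n) (1\<^sub>m n)"
    proof -
      have "c * c + s * s = 1\<^sub>m n" "t * t + c * c = 1\<^sub>m n" "c * t + s * c = 0\<^sub>m n n" "t * c + c * s = 0\<^sub>m n n"
        unfolding c_def s_def t_def mat_diag_diag of_real_mult[symmetric] using q
        by (auto intro!: eq_matI simp: mat_diag_def less_imp_le simp flip: of_real_add)
      then show ?thesis by simp
    qed
    finally show ?thesis by simp
  qed
  \<comment> \<open>The off-diagonal blocks will cancel, so only their existence and size are
    recorded.\<close>
  have conj: "\<exists>Q Q'. Q \<in> carrier_mat n n \<and> Q' \<in> carrier_mat n n \<and> W\<^sup>H * block_diag n D1 D2 * W =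
    four_block_mat (c * D1 * c + s * D2 * s) Q Q' (t * D1 * t + c * D2 * c)"
    if [simp]: "D1 \<in> carrier_mat n n" "D2 \<in> carrier_mat n n" for D1 D2
  proof -
    have "W\<^sup>H * block_diag n D1 D2 = four_block_mat (c * D1) (s * D2) (t * D1) (c * D2)"
      unfolding WH by (simp add: mult_four_block_mat[of _ n n _ n _ n _ _ n _ n] mult_carrier_mat[where n = n]
          right_mult_zero_mat[of _ n n] left_add_zero_mat[of _ n n] right_add_zero_mat[of _ n n])
    also have "\<dots> * W = four_block_mat (c * D1 * c + s * D2 * s) (c * D1 * t + s * D2 * c) (t * D1 * c + c * D2 * s)
      (t * D1 * t + c * D2 * c)"
      unfolding W_def by (simp add: mult_four_block_mat[of _ n n _ n _ n _ _ n _ n] mult_carrier_mat[where n = n])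
    finally show ?thesis
      by (intro exI[of _ "c * D1 * t + s * D2 * c"] exI[of _ "t * D1 * c + c * D2 * s"])
        (simp add: mult_carrier_mat[where n = n])
  qed
  define P where "P = c * C1 * c + s * C2 * s"
  define R where "R = t * C1 * t + c * C2 * c"
  have PR: "pos_def n P" "pos_def n R" unfolding P_def R_def using C by (auto intro!: pos pos')
  then show "pos_def n (c * C1 * c + s * C2 * s)" by (simp add: P_def)
  have PRc: "P \<in> carrier_mat n n" "R \<in> carrier_mat n n" using PR by (auto intro: pos_def_carrier)
  define M where "M = W\<^sup>H * block_diag n C1 C2 * W"
  obtain Q Q' where Q: "Q \<in> carrier_mat n n" "Q' \<in> carrier_mat n n" "M = four_block_mat P Q Q' R"
    using conj[of C1 C2] C unfolding M_def P_def R_def by (auto simp: pos_def_carrier)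
  note bd = block_diag_pos_def_mat_fun[OF C]
  have M: "pos_def (n + n) M" "mat_fun f M = W\<^sup>H * block_diag n (mat_fun f C1) (mat_fun f C2) * W"
    unfolding M_def using mat_fun_unitary_conj[OF bd(1) W WW] by (simp_all add: bd(2))
  define P' where "P' = complex_of_real (1 + \<epsilon>) \<cdot>\<^sub>m P"
  define R' where "R' = complex_of_real (1 + 1 / \<epsilon>) \<cdot>\<^sub>m R"
  have PR': "pos_def n P'" "pos_def n R'"
    unfolding P'_def R'_def by (intro pos_def_smult PR; use eps in \<open>auto intro: add_pos_pos\<close>)+
  define N where "N = block_diag n P' R'"
  \<comment> \<open>With the weights \<open>sqrt \<epsilon>\<close> and
    \<open>- 1 / sqrt \<epsilon>\<close>, the diagonal blocks of \<open>J * M * J\<close> are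
    \<open>P\<close> times \<open>\<epsilon>\<close> and \<open>R\<close> times
    \<open>1 / \<epsilon>\<close>, and its off-diagonal blocks are the negatives of those of
    \<open>M\<close>. This explains the factors in \<open>P'\<close> and \<open>R'\<close>.\<close>
  define j where "j i = (if i < n then sqrt \<epsilon> else - 1 / sqrt \<epsilon>)" for i
  define J where "J = rdiag (n + n) j"
  have Mc: "M \<in> carrier_mat (n + n) (n + n)" using M(1) by (rule pos_def_carrier)
  have JMJ: "J * M * J = mat (n + n) (n + n) (\<lambda>(i, k). j i * M $$ (i, k) * j k)"
    unfolding J_def using Mc
    by (simp add: mat_diag_mult_left[of _ "n + n" "n + n"] mat_diag_mult_right[of _ "n + n" "n + n"])
       (intro eq_matI, auto)
  have sq: "complex_of_real (sqrt \<epsilon>) * complex_of_real (sqrt \<epsilon>) = \<epsilon>"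
    using eps by (simp flip: of_real_mult)
  have "N = M + J * M * J"
  proof (rule eq_matI)
    fix i k assume "i < dim_row (M + J * M * J)" "k < dim_col (M + J * M * J)"
    then have ik: "i < n + n" "k < n + n" unfolding JMJ by auto
    have "(M + J * M * J) $$ (i, k) = M $$ (i, k) + j i * M $$ (i, k) * j k"
      unfolding JMJ using ik Mc by simp
    also have "\<dots> = N $$ (i, k)"
      using ik PRc eps sq unfolding Q(3)
      by (auto simp: N_def P'_def R'_def j_def field_simps)
    finally show "N $$ (i, k) = (M + J * M * J) $$ (i, k)" ..
  qed (use carrier_matD[OF PRc(1)] carrier_matD[OF PRc(2)] in \<open>simp_all add: N_def P'_def R'_def JMJ\<close>)
  from loewner_le_add_congruence[OF M(1) _ _ this]
  have N: "pos_def (n + n) N" "loewner_le (n + n) M N"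
    by (simp_all add: J_def)
  \<comment> \<open>Monotonicity is invoked at the doubled size; afterwards only the upper left
    corner is kept, so the possibly large factor in \<open>R'\<close> does no harm.\<close>
  have "loewner_le (n + n) (mat_fun f M) (mat_fun f N)"
    using f M(1) N by (auto simp: operator_monotone_def)
  moreover have fN: "mat_fun f N = block_diag n (mat_fun f P') (mat_fun f R')"
    unfolding N_def by (rule block_diag_pos_def_mat_fun[OF PR'])
  moreover obtain X Y where XY: "X \<in> carrier_mat n n" "Y \<in> carrier_mat n n"
    "mat_fun f M = four_block_mat (c * mat_fun f C1 * c + s * mat_fun f C2 * s) X Y
       (t * mat_fun f C1 * t + c * mat_fun f C2 * c)"
    unfolding M(2) using conj[of "mat_fun f C1" "mat_fun f C2"] C by (auto simp: mat_fun_carrier)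
  ultimately have le: "loewner_le (n + n)
      (four_block_mat (c * mat_fun f C1 * c + s * mat_fun f C2 * s) X Y
        (t * mat_fun f C1 * t + c * mat_fun f C2 * c))
      (block_diag n (mat_fun f P') (mat_fun f R'))" by simp
  have h: "hermitian_mat n (c * mat_fun f C1 * c + s * mat_fun f C2 * s)"
    "hermitian_mat n (t * mat_fun f C1 * t + c * mat_fun f C2 * c)"
    using hermitian_congruence[OF mat_fun_hermitian[OF C(1)] car(1), of f]
      hermitian_congruence[OF mat_fun_hermitian[OF C(2)] car(2), of f]
      hermitian_congruence[OF mat_fun_hermitian[OF C(1)] car(3), of f]
      hermitian_congruence[OF mat_fun_hermitian[OF C(2)] car(1), of f]
    by (simp_all add: adj hermitian_add)
  show "loewner_le n (c * mat_fun f C1 * c + s * mat_fun f C2 * s)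
      (mat_fun f (complex_of_real (1 + \<epsilon>) \<cdot>\<^sub>m (c * C1 * c + s * C2 * s)))"
    unfolding P_def[symmetric] P'_def[symmetric]
    by (rule loewner_le_corner[OF le])
      (intro XY carrier_mat_hermitian[OF h(1)] carrier_mat_hermitian[OF h(2)] zero_carrier_mat
        mat_fun_carrier[OF PR'(1)] mat_fun_carrier[OF PR'(2)] h(1) mat_fun_hermitian[OF PR'(1)])+
qed

lemma loewner_le_rdiagD:
  assumes "loewner_le n (rdiag n d) (rdiag n e)" and "i < n"
  shows "d i \<le> e i"
proof -
  have "qform (rdiag n d) (unit_vec n i) \<le> qform (rdiag n e) (unit_vec n i)"
    using assms by (auto simp: loewner_le_iff)
  then show ?thesis using assms(2) by (simp add: qform_unit_vec mat_diag_def)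
qed

text \<open>The quotient \<open>f x / x\<close> is nonincreasing: this is the scalar case of
  \<open>jensen_dilated\<close>, with weight \<open>p\<close> at \<open>x\<close> and the rest at a
  small positive \<open>y\<close>, after dropping the positive term with \<open>f y\<close>. The
  loss is a factor \<open>u < 1\<close>, and \<open>u\<close> is arbitrary.\<close>

lemma op_mono_class_quotient_antimono:
  assumes f: "f \<in> op_mono_class" and z: "0 < z" "z < x"
  shows "z / x * f x \<le> f z"
proof (rule field_le_mult_one_interval)
  have fpos: "f y > 0" if "y > 0" for y using f that by (auto simp: op_mono_class_def)
  fix u :: real assume u: "0 < u" "u < 1"
  \<comment> \<open>Taking \<open>p\<close> strictly below \<open>z / x\<close> leaves a gap between
    \<open>p * x\<close> and \<open>z\<close>, which has to accommodate both \<open>y\<close> and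
    the factor \<open>1 + \<epsilon>\<close>.\<close>
  define p where "p = u * (z / x)"
  have p: "0 < p" "p < 1" using u z mult_strict_mono[of u 1 "z / x" 1] by (auto simp: p_def)
  have px: "p * x < z" using u z by (simp add: p_def)
  \<comment> \<open>Half of the gap, so that the weighted average \<open>w\<close> stays strictly
    below \<open>z\<close>.\<close>
  define y where "y = (z - p * x) / 2"
  have y: "y > 0" using px by (simp add: y_def)
  define w where "w = p * x + (1 - p) * y"
  have "(1 - p) * y \<le> 1 * y" using p y by (intro mult_right_mono) auto
  moreover have "p * x + y < z" using px by (simp add: y_def field_simps)
  ultimately have "w < z" by (simp add: w_def)
  moreover have "w > 0" using p y z by (auto simp: w_def intro!: add_pos_pos mult_pos_pos)
  ultimately have w: "w < z" "w > 0" by auto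
  \<comment> \<open>Chosen so that \<open>(1 + \<epsilon>) * w\<close> is exactly
    \<open>z\<close>.\<close>
  define \<epsilon> where "\<epsilon> = z / w - 1"
  have eps: "\<epsilon> > 0" "(1 + \<epsilon>) * w = z" using w by (auto simp: \<epsilon>_def)
  have D: "rdiag 1 (\<lambda>_. a) * rdiag 1 (\<lambda>_. b) * rdiag 1 (\<lambda>_. a) = rdiag 1 (\<lambda>_. a * a * b)" for a b
    by (simp add: mult_ac)
  have S: "rdiag 1 (\<lambda>_. a) + rdiag 1 (\<lambda>_. b) = rdiag 1 (\<lambda>_. a + b)"
    "complex_of_real a \<cdot>\<^sub>m rdiag 1 (\<lambda>_. b) = rdiag 1 (\<lambda>_. a * b)" for a b
    by (auto intro!: eq_matI simp: mat_diag_def)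
  have "loewner_le 1 (rdiag 1 (\<lambda>_. p * f x + (1 - p) * f y)) (rdiag 1 (\<lambda>_. f ((1 + \<epsilon>) * w)))"
    using jensen_dilated(2)[of f 1 "\<lambda>_. p" "rdiag 1 (\<lambda>_. x)" "rdiag 1 (\<lambda>_. y)" \<epsilon>] f p y z eps(1)
    unfolding mat_fun_rdiag D S w_def
    by (simp add: op_mono_class_def pos_def_rdiag_iff)
  from loewner_le_rdiagD[OF this, of 0] eps(2) have "p * f x + (1 - p) * f y \<le> f z" by simp
  moreover have "(1 - p) * f y \<ge> 0" using p fpos[OF y] by auto
  ultimately show "u * (z / x * f x) \<le> f z" by (simp add: p_def)
qed

lemma loewner_le_limit:
  assumes "hermitian_mat n X" "hermitian_mat n Y"
    and "\<And>\<epsilon>. \<epsilon> > 0 \<Longrightarrow> loewner_le n X (complex_of_real (1 + \<epsilon>) \<cdot>\<^sub>m Y)"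
  shows "loewner_le n X Y"
  unfolding loewner_le_iff
proof (intro conjI ballI assms(1,2))
  fix x :: "complex vec" assume x: "x \<in> carrier_vec n"
  have *: "qform X x \<le> (1 + \<epsilon>) * qform Y x" if "\<epsilon> > 0" for \<epsilon>
    using assms(3)[OF that] x qform_smult[OF carrier_mat_hermitian[OF assms(2)] x, of "1 + \<epsilon>"]
    by (auto simp: loewner_le_iff)
  show "qform X x \<le> qform Y x"
  proof (rule field_le_epsilon)
    fix e :: real assume e: "e > 0"
    \<comment> \<open>The added 1 keeps the denominator positive when the form of \<open>Y\<close>
      vanishes at \<open>x\<close>.\<close>
    define \<epsilon> where "\<epsilon> = e / (\<bar>qform Y x\<bar> + 1)"
    have pos: "\<epsilon> > 0" using e by (simp add: \<epsilon>_def)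
    then have "\<epsilon> * qform Y x \<le> \<epsilon> * (\<bar>qform Y x\<bar> + 1)"
      by (intro mult_left_mono) auto
    moreover have "\<epsilon> * (\<bar>qform Y x\<bar> + 1) = e" by (simp add: \<epsilon>_def)
    ultimately show "qform X x \<le> qform Y x + e"
      using *[OF pos] by (simp add: algebra_simps)
  qed
qed

text \<open>Removes \<open>\<epsilon>\<close> from \<open>jensen_dilated\<close>: since
  \<open>f x / x\<close> is nonincreasing, the factor \<open>1 + \<epsilon>\<close> moves from the
  argument of \<open>f\<close> to the outside, where it tends to 1 as a scalar.\<close>

lemma jensen:
  assumes f: "f \<in> op_mono_class" and q: "\<And>i. i < n \<Longrightarrow> 0 < q i \<and> q i < 1"
    and C: "pos_def n C1" "pos_def n C2"
  defines "c \<equiv> rdiag n (\<lambda>i. sqrt (q i))" and "s \<equiv> rdiag n (\<lambda>i. sqrt (1 - q i))"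
  shows "loewner_le n (c * mat_fun f C1 * c + s * mat_fun f C2 * s)
      (mat_fun f (c * C1 * c + s * C2 * s))"
proof -
  have mono: "operator_monotone f" and fpos: "\<And>x. x > 0 \<Longrightarrow> f x > 0"
    using f by (auto simp: op_mono_class_def)
  define P where "P = c * C1 * c + s * C2 * s"
  have P: "pos_def n P"
    unfolding P_def c_def s_def using jensen_dilated(1)[OF mono _ C, of q 1] q by simp
  show ?thesis unfolding P_def[symmetric]
  proof (rule loewner_le_limit)
    show "hermitian_mat n (mat_fun f P)" using P by (rule mat_fun_hermitian)
    fix \<epsilon> :: real assume eps: "\<epsilon> > 0"
    have 1: "loewner_le n (c * mat_fun f C1 * c + s * mat_fun f C2 * s)
      (mat_fun f (complex_of_real (1 + \<epsilon>) \<cdot>\<^sub>m P))"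
      unfolding P_def c_def s_def using jensen_dilated(2)[OF mono _ C eps, of q] q by simp
    have "f ((1 + \<epsilon>) * x) \<le> (1 + \<epsilon>) * f x" if "x > 0" for x
    proof -
      have "x / ((1 + \<epsilon>) * x) = 1 / (1 + \<epsilon>)" using that by simp
      then have "f ((1 + \<epsilon>) * x) / (1 + \<epsilon>) \<le> f x"
        using op_mono_class_quotient_antimono[OF f that, of "(1 + \<epsilon>) * x"] that eps by simp
      then show ?thesis using eps by (simp add: pos_divide_le_eq mult.commute)
    qed
    then have "loewner_le n (mat_fun f (complex_of_real (1 + \<epsilon>) \<cdot>\<^sub>m P))
        (complex_of_real (1 + \<epsilon>) \<cdot>\<^sub>m mat_fun f P)"
      unfolding mat_fun_smult[OF P] by (rule mat_fun_loewner_le[OF P])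
    with 1 show "loewner_le n (c * mat_fun f C1 * c + s * mat_fun f C2 * s)
        (complex_of_real (1 + \<epsilon>) \<cdot>\<^sub>m mat_fun f P)"
      by (rule loewner_le_trans)
  next
    show "hermitian_mat n (c * mat_fun f C1 * c + s * mat_fun f C2 * s)"
      \<comment> \<open>The Loewner order includes that its left side is Hermitian, so the
        inequality at \<open>\<epsilon> = 1\<close> supplies it.\<close>
      using jensen_dilated(2)[OF mono _ C, of q 1] q by (simp add: loewner_le_iff c_def s_def)
  qed
qed

section \<open>Superadditivity of operator means\<close>

lemma congruence_add:
  assumes "X \<in> carrier_mat n n" "Y \<in> carrier_mat n n" "Z \<in> carrier_mat n n"
  shows "Z\<^sup>H * X * Z + Z\<^sup>H * Y * Z = Z\<^sup>H * (X + Y) * Z"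
  using assms mat_adjoint_carrier[OF assms(3)]
  by (simp add: mult_add_distrib_mat[of _ n n _ n] add_mult_distrib_mat[of _ n n _ _ n]
      mult_carrier_mat[where n = n])

lemma congruence_cancel:
  fixes A Z Y :: "complex mat"
  assumes "A \<in> carrier_mat n n" "Z \<in> carrier_mat n n" "Y \<in> carrier_mat n n" "Z * Y = 1\<^sub>m n"
  shows "Y\<^sup>H * (Z\<^sup>H * A * Z) * Y = A"
  using congruence_mult[OF assms(1-3)] assms by simp

lemma op_mean_rdiag:
  "op_mean f (rdiag n p) B = rdiag n (\<lambda>i. sqrt (p i)) *
     mat_fun f (rdiag n (\<lambda>i. 1 / sqrt (p i)) * B * rdiag n (\<lambda>i. 1 / sqrt (p i))) *
     rdiag n (\<lambda>i. sqrt (p i))"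
  by (simp only: op_mean_def Let_def mat_fun_rdiag)

text \<open>A congruence turns \<open>A1 + A2\<close> into the identity and diagonalizes \<open>A1\<close> and \<open>A2\<close>.\<close>

theorem op_mean_superadditive:
  assumes f: "f \<in> op_mono_class"
    and A1: "pos_def n A1" and A2: "pos_def n A2" and B1: "pos_def n B1" and B2: "pos_def n B2"
  shows "loewner_le n (op_mean f A1 B1 + op_mean f A2 B2) (op_mean f (A1 + A2) (B1 + B2))"
proof -
  have fpos: "f x > 0" if "x > 0" for x using f that by (auto simp: op_mono_class_def)
  define S where "S = A1 + A2"
  have S: "pos_def n S" unfolding S_def using A1 A2 by (rule pos_def_add)
  obtain Z Y q where Z: "Z \<in> carrier_mat n n" "Y \<in> carrier_mat n n" "Z * Y = 1\<^sub>m n" "Y * Z = 1\<^sub>m n"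
    "S = Z\<^sup>H * Z" "A1 = Z\<^sup>H * rdiag n q * Z" "\<And>i. i < n \<Longrightarrow> q i > 0"
    using simultaneous_congruence[OF S A1] by blast
  \<comment> \<open>Congruence by the inverse of \<open>Z\<close>: it sends \<open>S\<close> to the
    identity and \<open>A1\<close> to \<open>rdiag n q\<close>.\<close>
  define T where "T X = Y\<^sup>H * X * Y" for X
  have T_inv: "Z\<^sup>H * T X * Z = X" if "X \<in> carrier_mat n n" for X
    unfolding T_def using congruence_cancel[OF that Z(2,1,4)] .
  have T_pos: "pos_def n (T X)" if "pos_def n X" for X
    unfolding T_def by (rule pos_def_congruence[OF that Z(2,1,3)])
  note car = A1[THEN pos_def_carrier] A2[THEN pos_def_carrier]
    B1[THEN pos_def_carrier] B2[THEN pos_def_carrier]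
  have TA1: "T A1 = rdiag n q"
    unfolding T_def Z(6) by (rule congruence_cancel[OF mat_diag_dim Z(1-3)])
  have TS: "T S = rdiag n (\<lambda>_. 1)"
    unfolding T_def Z(5) using congruence_cancel[OF one_carrier_mat Z(1-3)] Z(1) by simp
  have TA2: "T A2 = rdiag n (\<lambda>i. 1 - q i)"
  proof -
    have c: "T A2 \<in> carrier_mat n n" using T_pos[OF A2] by (rule pos_def_carrier)
    have "T A1 + T A2 = T S"
      unfolding T_def S_def by (rule congruence_add[OF car(1,2) Z(2)])
    moreover have "T A2 = (T A1 + T A2) - T A1"
      using c pos_def_carrier[OF T_pos[OF A1]] by (intro eq_matI) auto
    ultimately have "T A2 = rdiag n (\<lambda>_. 1) - rdiag n q"
      by (simp only: TA1 TS)
    then show ?thesis by (auto intro!: eq_matI simp: mat_diag_def)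
  qed
  \<comment> \<open>Positivity of the transformed \<open>A2\<close> puts \<open>q i\<close> strictly
    between 0 and 1, as the weights in Jensen's inequality require.\<close>
  have q1: "q i < 1" if "i < n" for i
    using T_pos[OF A2, unfolded TA2 pos_def_rdiag_iff] that by simp
  define c where "c = rdiag n (\<lambda>i. sqrt (q i))"
  define s where "s = rdiag n (\<lambda>i. sqrt (1 - q i))"
  define ci where "ci = rdiag n (\<lambda>i. 1 / sqrt (q i))"
  define si where "si = rdiag n (\<lambda>i. 1 / sqrt (1 - q i))"
  have cs [simp]: "c \<in> carrier_mat n n" "s \<in> carrier_mat n n" "ci \<in> carrier_mat n n" "si \<in> carrier_mat n n"
    by (simp_all add: c_def s_def ci_def si_def)
  have adj: "ci\<^sup>H = ci" "si\<^sup>H = si" "c\<^sup>H = c" "s\<^sup>H = s"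
    by (simp_all only: ci_def si_def c_def s_def mat_adjoint_rdiag)
  have inv: "c * ci = 1\<^sub>m n" "s * si = 1\<^sub>m n" "ci * c = 1\<^sub>m n" "si * s = 1\<^sub>m n"
    unfolding ci_def c_def si_def s_def mat_diag_diag of_real_mult[symmetric]
    by (subst rdiag_one[symmetric], rule rdiag_cong, use Z(7) q1 in force)+
  \<comment> \<open>\<open>C1\<close> and \<open>C2\<close> are the matrices to which
    \<open>op_mean\<close> applies \<open>f\<close> once the first arguments are
    \<open>rdiag n q\<close> and its complement; thus the terms on the left of Jensen's inequality
    are exactly the two means.\<close>
  define C1 where "C1 = ci * T B1 * ci"
  define C2 where "C2 = si * T B2 * si"
  have C: "pos_def n C1" "pos_def n C2"
    unfolding C1_def C2_def
    using pos_def_congruence[OF T_pos[OF B1] cs(3,1) inv(1)] pos_def_congruence[OF T_pos[OF B2] cs(4,2) inv(2)]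
    by (simp_all add: adj)
  have cC: "c * C1 * c = T B1" "s * C2 * s = T B2"
    unfolding C1_def C2_def
    using congruence_cancel[OF pos_def_carrier[OF T_pos[OF B1]] cs(3,1) inv(3)]
      congruence_cancel[OF pos_def_carrier[OF T_pos[OF B2]] cs(4,2) inv(4)]
    by (simp_all add: adj)
  have B12: "T B1 + T B2 = T (B1 + B2)"
    unfolding T_def by (rule congruence_add[OF car(3,4) Z(2)])
  have "loewner_le n (c * mat_fun f C1 * c + s * mat_fun f C2 * s) (mat_fun f (c * C1 * c + s * C2 * s))"
    unfolding c_def s_def by (rule jensen[OF f _ C]) (use Z(7) q1 in auto)
  moreover have "c * mat_fun f C1 * c = op_mean f (T A1) (T B1)"
    unfolding TA1 op_mean_rdiag C1_def c_def ci_def ..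
  moreover have "s * mat_fun f C2 * s = op_mean f (T A2) (T B2)"
    unfolding TA2 op_mean_rdiag C2_def s_def si_def ..
  \<comment> \<open>The first argument \<open>T S\<close> is the identity, so the mean is just
    \<open>f\<close> of the second argument.\<close>
  moreover have "mat_fun f (T (B1 + B2)) = op_mean f (T S) (T (B1 + B2))"
    unfolding TS op_mean_rdiag
    using T_pos[OF pos_def_add[OF B1 B2], THEN pos_def_carrier]
      mat_fun_carrier[OF T_pos[OF pos_def_add[OF B1 B2]], of f] by simp
  ultimately have le: "loewner_le n (op_mean f (T A1) (T B1) + op_mean f (T A2) (T B2)) (op_mean f (T S) (T (B1 + B2)))"
    by (simp add: cC B12)
  have cong: "Z\<^sup>H * op_mean f (T X) (T X') * Z = op_mean f X X'" if "pos_def n X" "pos_def n X'" for X X'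
    using op_mean_congruence[OF T_pos[OF that(1)] T_pos[OF that(2)] Z(1,2,4), of f] that
    by (simp add: T_inv pos_def_carrier)
  show ?thesis
    using loewner_le_congruence[OF le Z(1)]
      congruence_add[OF op_mean_carrier[OF T_pos[OF A1] T_pos[OF B1], of f] op_mean_carrier[OF T_pos[OF A2] T_pos[OF B2], of f] Z(1)]
    by (simp add: cong A1 A2 B1 B2 S pos_def_add flip: S_def)
qed

section \<open>Inversion and the function \<open>1 / f (1 / x)\<close>\<close>

text \<open>The functional calculus yields a left inverse of \<open>X\<close>, and associativity
  identifies it with the right inverse \<open>W\<close>.\<close>

lemma mat_fun_inverse_unique:
  assumes "pos_def n X" "W \<in> carrier_mat n n" "X * W = 1\<^sub>m n"
  shows "mat_fun (\<lambda>x. 1 / x) X = W"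
proof -
  define I where "I = mat_fun (\<lambda>x. 1 / x) X"
  have c: "I \<in> carrier_mat n n" "X \<in> carrier_mat n n"
    using assms(1) by (auto simp: I_def mat_fun_carrier pos_def_carrier)
  have "I * X = mat_fun (\<lambda>x. 1 / x) X * mat_fun (\<lambda>x. x) X"
    using assms(1) by (simp add: mat_fun_id I_def)
  also have "\<dots> = mat_fun (\<lambda>x. 1) X"
    unfolding mat_fun_mult[OF assms(1)] by (rule mat_fun_cong[OF assms(1)]) simp
  finally have "I * X = 1\<^sub>m n" by (simp add: mat_fun_const_one[OF assms(1)])
  moreover have "I * (X * W) = (I * X) * W"
    using c assms(2) by (simp add: assoc_mult_mat[of _ n n _ n _ n])
  ultimately show ?thesis using assms c by (simp add: I_def)
qed

text \<open>After a simultaneous congruence the order says \<open>1 \<le> d i\<close>, and the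
  inverses are the congruences by the adjoint of \<open>V\<close> of the reciprocal
  diagonals.\<close>

lemma mat_fun_inverse_antimono:
  assumes "pos_def n X" "pos_def n Y" "loewner_le n X Y"
  shows "loewner_le n (mat_fun (\<lambda>x. 1 / x) Y) (mat_fun (\<lambda>x. 1 / x) X)"
proof -
  obtain Z V d where Z: "Z \<in> carrier_mat n n" "V \<in> carrier_mat n n" "Z * V = 1\<^sub>m n" "V * Z = 1\<^sub>m n"
    "X = Z\<^sup>H * Z" "Y = Z\<^sup>H * rdiag n d * Z" "\<And>i. i < n \<Longrightarrow> d i > 0"
    using simultaneous_congruence[OF assms(1,2)] by blast
  have X: "X = Z\<^sup>H * rdiag n (\<lambda>_. 1) * Z" using Z(1,5) by simp
  have d1: "1 \<le> d i" if "i < n" for i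
  proof -
    have "loewner_le n (rdiag n (\<lambda>_. 1)) (rdiag n d)"
      using loewner_le_congruence[OF assms(3) Z(2)]
      unfolding X Z(6) congruence_cancel[OF mat_diag_dim Z(1-3)] .
    then show ?thesis using that by (rule loewner_le_rdiagD)
  qed
  have VZ: "Z\<^sup>H * V\<^sup>H = 1\<^sub>m n"
    using arg_cong[OF Z(4), of mat_adjoint] Z(1,2) by (simp add: mat_adjoint_mult[of _ n n _ n])
  \<comment> \<open>The double adjoint \<open>(V\<^sup>H)\<^sup>H\<close> in place of
    \<open>V\<close> gives the shape in which \<open>loewner_le_congruence\<close> applies.\<close>
  have inv: "mat_fun (\<lambda>x. 1 / x) (Z\<^sup>H * rdiag n e * Z) = (V\<^sup>H)\<^sup>H * rdiag n (\<lambda>i. 1 / e i) * V\<^sup>H"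
    if "pos_def n (Z\<^sup>H * rdiag n e * Z)" "\<And>i. i < n \<Longrightarrow> e i > 0" for e
  proof (rule mat_fun_inverse_unique[OF that(1)])
    note a = assoc_mult_mat[where ?n\<^sub>1 = n and ?n\<^sub>2 = n and ?n\<^sub>3 = n and ?n\<^sub>4 = n]
    note [simp] = Z(1,2) mat_adjoint_carrier[OF Z(1)] mat_adjoint_carrier[OF Z(2)]
      mult_carrier_mat[where n = n] a
      left_mult_one_mat[where nr = n and nc = n] right_mult_one_mat[where nr = n and nc = n]
    have c: "Z * (V * M) = M" if "M \<in> carrier_mat n n" for M
      using that Z(3) by (simp flip: a del: assoc_mult_mat)
    define D where "D = rdiag n (\<lambda>i. 1 / e i)"
    have D [simp]: "D \<in> carrier_mat n n" by (simp add: D_def)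
    have "rdiag n e * D = 1\<^sub>m n"
      unfolding D_def mat_diag_diag of_real_mult[symmetric]
      by (subst rdiag_one[symmetric], rule rdiag_cong, use that(2) in force)
    then have e: "rdiag n e * (D * M) = M" if "M \<in> carrier_mat n n" for M
      using that by (simp flip: a del: assoc_mult_mat)
    show "(Z\<^sup>H * rdiag n e * Z) * ((V\<^sup>H)\<^sup>H * rdiag n (\<lambda>i. 1 / e i) * V\<^sup>H) = 1\<^sub>m n"
      unfolding D_def[symmetric] using VZ by (simp add: c e)
    show "(V\<^sup>H)\<^sup>H * rdiag n (\<lambda>i. 1 / e i) * V\<^sup>H \<in> carrier_mat n n" by simp
  qed
  have pd: "pos_def n (Z\<^sup>H * rdiag n (\<lambda>_. 1) * Z)" "pos_def n (Z\<^sup>H * rdiag n d * Z)"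
    using assms(1,2) X Z(6) by metis+
  have "mat_fun (\<lambda>x. 1 / x) X = (V\<^sup>H)\<^sup>H * rdiag n (\<lambda>i. 1 / 1) * V\<^sup>H"
    unfolding X by (rule inv[OF pd(1)]) simp
  moreover have "mat_fun (\<lambda>x. 1 / x) Y = (V\<^sup>H)\<^sup>H * rdiag n (\<lambda>i. 1 / d i) * V\<^sup>H"
    unfolding Z(6) by (rule inv[OF pd(2) Z(7)])
  moreover have "loewner_le n ((V\<^sup>H)\<^sup>H * rdiag n (\<lambda>i. 1 / d i) * V\<^sup>H)
      ((V\<^sup>H)\<^sup>H * rdiag n (\<lambda>i. 1 / 1) * V\<^sup>H)"
    by (intro loewner_le_congruence[of n] loewner_le_rdiag mat_adjoint_carrier Z(2))
      (use d1 Z(7) in \<open>simp add: divide_le_eq\<close>)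
  ultimately show ?thesis by (simp only:)
qed

text \<open>\<open>f\<close> is placed between two inversions, each of which reverses the
  order.\<close>

lemma op_mono_class_adjoint:
  assumes "f \<in> op_mono_class"
  shows "(\<lambda>x. 1 / f (1 / x)) \<in> op_mono_class"
proof -
  let ?i = "\<lambda>x :: real. 1 / x"
  have fpos: "f x > 0" if "x > 0" for x using assms that by (auto simp: op_mono_class_def)
  have "operator_monotone (\<lambda>x. 1 / f (1 / x))"
    unfolding operator_monotone_def
  proof (intro allI impI, elim conjE)
    fix n X Y assume X: "pos_def n X" and Y: "pos_def n Y" and XY: "loewner_le n X Y"
    have i: "pos_def n (mat_fun ?i X)" "pos_def n (mat_fun ?i Y)"
      using X Y by (auto intro!: mat_fun_pos_def)
    have "loewner_le n (mat_fun f (mat_fun ?i Y)) (mat_fun f (mat_fun ?i X))"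
      using assms i mat_fun_inverse_antimono[OF X Y XY] by (auto simp: op_mono_class_def operator_monotone_def)
    then have "loewner_le n (mat_fun ?i (mat_fun f (mat_fun ?i X))) (mat_fun ?i (mat_fun f (mat_fun ?i Y)))"
      using i by (intro mat_fun_inverse_antimono mat_fun_pos_def[OF i(1)] mat_fun_pos_def[OF i(2)] fpos)
    then show "loewner_le n (mat_fun (\<lambda>x. 1 / f (1 / x)) X) (mat_fun (\<lambda>x. 1 / f (1 / x)) Y)"
      by (simp only: mat_fun_comp[OF i(1)] mat_fun_comp[OF i(2)] mat_fun_comp[OF X] mat_fun_comp[OF Y])
  qed
  then show ?thesis using assms fpos by (auto simp: op_mono_class_def)
qed

text \<open>For positive \<open>x\<close>, \<open>x * perp_fun f (1 / x)\<close> simplifies to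
  \<open>1 / f (1 / x)\<close>. Swapping the arguments thus leads to a function known to lie in
  \<open>op_mono_class\<close>.\<close>

lemma op_mean_perp_fun:
  assumes "pos_def n A" "pos_def n B"
  shows "op_mean (perp_fun f) A B = op_mean (\<lambda>x. 1 / f (1 / x)) B A"
  unfolding op_mean_transpose[OF assms] by (rule op_mean_cong[OF assms(2,1)]) (simp add: perp_fun_def)

lemma op_mean_perp_fun_superadditive:
  assumes "f \<in> op_mono_class" "pos_def n A1" "pos_def n A2" "pos_def n B1" "pos_def n B2"
  shows "loewner_le n (op_mean (perp_fun f) A1 B1 + op_mean (perp_fun f) A2 B2)
    (op_mean (perp_fun f) (A1 + A2) (B1 + B2))"
  using op_mean_superadditive[OF op_mono_class_adjoint[OF assms(1)] assms(4,5,2,3)] assms(2-5)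
  by (simp add: op_mean_perp_fun[of n] pos_def_add)

section \<open>Monotonicity of means and the geometric mean\<close>

lemma op_mono_class_sqrt: "sqrt \<in> op_mono_class"
  by (simp add: op_mono_class_def operator_monotone_sqrt)

lemma op_mean_mono_right:
  assumes "f \<in> op_mono_class" "pos_def n A" "pos_def n B" "pos_def n B'" "loewner_le n B B'"
  shows "loewner_le n (op_mean f A B) (op_mean f A B')"
proof -
  define R where "R = mat_fun sqrt A"
  define S where "S = mat_fun (\<lambda>t. 1 / sqrt t) A"
  note RS = mat_fun_sqrt[OF assms(2), folded R_def S_def]
  have "pos_def n (S\<^sup>H * B * S)" "pos_def n (S\<^sup>H * B' * S)"
    using assms by (auto intro!: pos_def_congruence[OF _ RS(2,1,6)])
  moreover have "loewner_le n (S\<^sup>H * B * S) (S\<^sup>H * B' * S)"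
    by (rule loewner_le_congruence[OF assms(5) RS(2)])
  ultimately have "loewner_le n (mat_fun f (S * B * S)) (mat_fun f (S * B' * S))"
    using assms(1) by (auto simp: op_mono_class_def operator_monotone_def RS(4))
  from loewner_le_congruence[OF this RS(1)] show ?thesis
    by (simp add: op_mean_def Let_def RS(3) flip: R_def S_def)
qed

lemma geom_mean_commute:
  assumes "pos_def n A" "pos_def n B"
  shows "geom_mean A B = geom_mean B A"
  unfolding op_mean_transpose[OF assms]
  by (rule op_mean_cong[OF assms(2,1)]) (simp add: real_sqrt_divide real_div_sqrt)

text \<open>Monotonicity in the second argument holds for every mean of the class; commutativity of
  the geometric mean carries it over to the first.\<close>

lemma geom_mean_mono:
  assumes "pos_def n A" "pos_def n B" "pos_def n A'" "pos_def n B'"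
    and "loewner_le n A A'" "loewner_le n B B'"
  shows "loewner_le n (geom_mean A B) (geom_mean A' B')"
proof -
  have "loewner_le n (geom_mean A B) (geom_mean A B')"
    using assms by (intro op_mean_mono_right op_mono_class_sqrt)
  moreover have "loewner_le n (geom_mean B' A) (geom_mean B' A')"
    using assms by (intro op_mean_mono_right op_mono_class_sqrt)
  ultimately show ?thesis
    using assms by (metis geom_mean_commute loewner_le_trans)
qed

text \<open>One congruence diagonalizes \<open>A\<close>, \<open>B\<close> and both means, and on
  the diagonal the product of \<open>f (q i)\<close> and \<open>q i / f (q i)\<close> is
  \<open>q i\<close>.\<close>

lemma geom_mean_op_mean_perp:
  assumes "pos_def n A" "pos_def n B" and fpos: "\<And>x. x > 0 \<Longrightarrow> f x > 0"
  shows "geom_mean (op_mean f A B) (op_mean (perp_fun f) A B) = geom_mean A B"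
proof -
  obtain Z Y q where Z: "Z \<in> carrier_mat n n" "Y \<in> carrier_mat n n" "Z * Y = 1\<^sub>m n" "Y * Z = 1\<^sub>m n"
    "A = Z\<^sup>H * Z" "B = Z\<^sup>H * rdiag n q * Z" "\<And>i. i < n \<Longrightarrow> q i > 0"
    using simultaneous_congruence[OF assms(1,2)] by blast
  have m: "op_mean g A B = Z\<^sup>H * rdiag n (\<lambda>i. g (q i)) * Z" for g
    using op_mean_congruent_one[of n Z g q] assms(1) Z by simp
  have "pos_def n (op_mean f A B)" using assms by (rule op_mean_pos_def)
  then have "geom_mean (op_mean f A B) (op_mean (perp_fun f) A B) =
      Z\<^sup>H * rdiag n (\<lambda>i. f (q i) * sqrt (perp_fun f (q i) / f (q i))) * Z"
    unfolding m using Z(1,7) by (intro op_mean_congruent_rdiag) (auto intro: fpos)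
  also have "rdiag n (\<lambda>i. f (q i) * sqrt (perp_fun f (q i) / f (q i))) = rdiag n (\<lambda>i. sqrt (q i))"
  proof (rule rdiag_cong)
    fix i assume "i < n"
    then have "f (q i) > 0" using Z(7) fpos by blast
    then show "f (q i) * sqrt (perp_fun f (q i) / f (q i)) = sqrt (q i)"
      by (simp add: perp_fun_def real_sqrt_divide)
  qed
  finally show ?thesis by (simp add: m)
qed

section \<open>Sums and sector matrices\<close>

lemma mat_sum_1: "F 1 \<in> carrier_mat n n \<Longrightarrow> mat_sum n F {1..1 :: nat} = F 1"
  by (intro eq_matI) (auto simp: mat_sum_def)

lemma mat_sum_Suc:
  "F (Suc k) \<in> carrier_mat n n \<Longrightarrow> mat_sum n F {1..Suc k} = mat_sum n F {1..k} + F (Suc k)"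
  by (intro eq_matI) (auto simp: mat_sum_def)

lemma mat_sum_pos_def:
  fixes k :: nat
  assumes "k \<ge> 1" "\<And>i. i \<in> {1..k} \<Longrightarrow> pos_def n (F i)"
  shows "pos_def n (mat_sum n F {1..k})"
  using assms
\<comment> \<open>The induction starts at 1: the empty sum is the zero matrix, which is not positive
  definite for positive size.\<close>
proof (induction k rule: nat_induct_at_least)
  case base
  then have "pos_def n (F 1)" by simp
  then show ?case by (simp only: mat_sum_1[OF pos_def_carrier])
next
  case (Suc k)
  then have "pos_def n (mat_sum n F {1..k})" "pos_def n (F (Suc k))" by simp_all
  then show ?case by (simp only: mat_sum_Suc[OF pos_def_carrier] pos_def_add)
qed

text \<open>Kept abstract in \<open>m\<close> because it is applied to three operations:
  \<open>geom_mean\<close>, \<open>op_mean f\<close> and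
  \<open>op_mean (perp_fun f)\<close>.\<close>

lemma mat_sum_superadditive:
  fixes k :: nat
  assumes "k \<ge> 1" "\<And>i. i \<in> {1..k} \<Longrightarrow> pos_def n (A i)" "\<And>i. i \<in> {1..k} \<Longrightarrow> pos_def n (B i)"
    and pos: "\<And>X Y. pos_def n X \<Longrightarrow> pos_def n Y \<Longrightarrow> pos_def n (m X Y)"
    and add: "\<And>X Y X' Y'. pos_def n X \<Longrightarrow> pos_def n Y \<Longrightarrow> pos_def n X' \<Longrightarrow> pos_def n Y' \<Longrightarrow>
      loewner_le n (m X X' + m Y Y') (m (X + Y) (X' + Y'))"
  shows "loewner_le n (mat_sum n (\<lambda>i. m (A i) (B i)) {1..k}) (m (mat_sum n A {1..k}) (mat_sum n B {1..k}))"
  using assms(1-3)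
proof (induction k rule: nat_induct_at_least)
  case base
  then have p: "pos_def n (A 1)" "pos_def n (B 1)" by simp_all
  show ?case
    using mat_sum_1[of A n] mat_sum_1[of B n] mat_sum_1[of "\<lambda>i. m (A i) (B i)" n] p pos[OF p]
    by (simp add: pos_def_carrier loewner_le_refl pos_def_hermitian)
next
  case (Suc k)
  let ?A = "mat_sum n A {1..k}" and ?B = "mat_sum n B {1..k}"
  have p: "pos_def n (A (Suc k))" "pos_def n (B (Suc k))" using Suc.prems by simp_all
  have q: "pos_def n ?A" "pos_def n ?B"
    by (rule mat_sum_pos_def[OF Suc.hyps], rule Suc.prems, simp)+
  have "loewner_le n (mat_sum n (\<lambda>i. m (A i) (B i)) {1..k} + m (A (Suc k)) (B (Suc k)))
      (m ?A ?B + m (A (Suc k)) (B (Suc k)))"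
    using Suc pos[OF p] by (intro loewner_le_add loewner_le_refl pos_def_hermitian) auto
  also have "loewner_le n \<dots> (m (?A + A (Suc k)) (?B + B (Suc k)))"
    using p q by (intro add)
  finally (loewner_le_trans) show ?case
    using p pos[OF p] by (simp only: mat_sum_Suc[OF pos_def_carrier])
qed

lemma loewner_le_scale:
  assumes "pos_def n X" "c \<ge> 1"
  shows "loewner_le n X (complex_of_real c \<cdot>\<^sub>m X)"
  unfolding loewner_le_iff
proof (intro conjI ballI)
  show h: "hermitian_mat n X" "hermitian_mat n (complex_of_real c \<cdot>\<^sub>m X)"
    using assms(1) by (auto intro: pos_def_hermitian hermitian_smult)
  fix x :: "complex vec" assume x: "x \<in> carrier_vec n"
  have "qform X x \<ge> 0"
    using assms(1) x by (cases "x = 0\<^sub>v n") (auto simp: pos_def_iff qform_zero[OF pos_def_carrier] less_imp_le)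
  then show "qform X x \<le> qform (complex_of_real c \<cdot>\<^sub>m X) x"
    using assms x mult_right_mono[of 1 c "qform X x"]
    by (simp add: qform_smult[OF pos_def_carrier[OF assms(1)]])
qed

section \<open>Real parts of sector matrices\<close>

lemma cscalar_prod_commute:
  fixes x y :: "complex vec"
  assumes "x \<in> carrier_vec n" "y \<in> carrier_vec n"
  shows "x \<bullet>c y = cnj (y \<bullet>c x)"
  using assms by (simp add: scalar_prod_def mult.commute)

lemma re_mat_qform:
  assumes "A \<in> carrier_mat n n" "x \<in> carrier_vec n"
  shows "qform (re_mat A) x = Re ((A *\<^sub>v x) \<bullet>c x)"
proof -
  have "(A\<^sup>H *\<^sub>v x) \<bullet>c x = x \<bullet>c (A *\<^sub>v x)"
    using adjoint_cscalar_prod[of "A\<^sup>H" n n x x] assms by simp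
  also have "\<dots> = cnj ((A *\<^sub>v x) \<bullet>c x)"
    using assms by (intro cscalar_prod_commute) auto
  finally have "qform (A\<^sup>H) x = Re ((A *\<^sub>v x) \<bullet>c x)" by (simp add: qform_def)
  moreover have "re_mat A = complex_of_real (1 / 2) \<cdot>\<^sub>m (A + A\<^sup>H)" by (simp add: re_mat_def)
  ultimately show ?thesis
    using assms qform_smult[of "A + A\<^sup>H" n x "1 / 2"] qform_add[of A n "A\<^sup>H" x]
    by (simp add: qform_def)
qed

lemma re_mat_hermitian: "A \<in> carrier_mat n n \<Longrightarrow> hermitian_mat n (re_mat A)"
  unfolding hermitian_mat_def re_mat_def by (auto intro!: eq_matI simp: add.commute)

text \<open>The sector condition speaks of unit vectors; a nonzero \<open>x\<close> is divided by
  its norm \<open>r\<close>, which scales the form by the positive factor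
  \<open>1 / r * (1 / r)\<close>.\<close>

lemma sector_mats_re_pos_def:
  assumes "A \<in> sector_mats n \<alpha>"
  shows "pos_def n (re_mat A)"
  unfolding pos_def_iff
proof (intro conjI ballI impI)
  have A: "A \<in> carrier_mat n n" using assms by (simp add: sector_mats_def)
  then show "hermitian_mat n (re_mat A)" by (rule re_mat_hermitian)
  fix x :: "complex vec" assume x: "x \<in> carrier_vec n" "x \<noteq> 0\<^sub>v n"
  then have "x \<bullet>c x > 0" by simp
  then have xx: "Re (x \<bullet>c x) > 0" "x \<bullet>c x = complex_of_real (Re (x \<bullet>c x))"
    by (auto simp: less_complex_def complex_eq_iff)
  define r where "r = sqrt (Re (x \<bullet>c x))"
  have r: "r > 0" "x \<bullet>c x = complex_of_real (r * r)" using xx by (auto simp: r_def)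
  define y where "y = complex_of_real (1 / r) \<cdot>\<^sub>v x"
  have y: "y \<in> carrier_vec n" using x by (simp add: y_def)
  have scal: "(complex_of_real a \<cdot>\<^sub>v u) \<bullet>c (complex_of_real a \<cdot>\<^sub>v x) = complex_of_real (a * a) * (u \<bullet>c x)"
    if "u \<in> carrier_vec n" for u a
    using that x by (simp add: conjugate_smult_vec smult_scalar_prod_distrib[of _ n] scalar_prod_smult_distrib[of _ n])
  have "y \<bullet>c y = 1"
    unfolding y_def scal[OF x(1)] r(2) using r(1) by (simp flip: of_real_mult)
  then have "Re ((A *\<^sub>v y) \<bullet>c y) > 0"
    using assms y by (auto simp: sector_mats_def)
  also have "(A *\<^sub>v y) \<bullet>c y = complex_of_real (1 / r * (1 / r)) * ((A *\<^sub>v x) \<bullet>c x)"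
    using scal[OF mult_mat_vec_carrier[OF A x(1)], of "1 / r"] mult_mat_vec[OF A x(1)]
    by (simp add: y_def)
  finally have "1 / r * (1 / r) * Re ((A *\<^sub>v x) \<bullet>c x) > 0" by (simp flip: of_real_mult of_real_divide)
  then show "qform (re_mat A) x > 0"
    using r(1) by (simp add: re_mat_qform[OF A x(1)] zero_less_mult_iff zero_less_divide_iff)
qed

lemma re_mat_mat_sum:
  assumes "\<And>i. i \<in> I \<Longrightarrow> A i \<in> carrier_mat n n"
  shows "re_mat (mat_sum n A I) = mat_sum n (\<lambda>i. re_mat (A i)) I"
proof (rule eq_matI)
  fix i j assume "i < dim_row (mat_sum n (\<lambda>i. re_mat (A i)) I)" "j < dim_col (mat_sum n (\<lambda>i. re_mat (A i)) I)"
  then have ij: "i < n" "j < n" by (auto simp: mat_sum_def)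
  have "mat_sum n (\<lambda>i. re_mat (A i)) I $$ (i, j) = (\<Sum>k\<in>I. re_mat (A k) $$ (i, j))"
    using ij by (simp add: mat_sum_def)
  also have "\<dots> = (\<Sum>k\<in>I. (A k $$ (i, j) + cnj (A k $$ (j, i))) / 2)"
  proof (rule sum.cong)
    fix k assume "k \<in> I"
    then have "A k \<in> carrier_mat n n" by (rule assms)
    then show "re_mat (A k) $$ (i, j) = (A k $$ (i, j) + cnj (A k $$ (j, i))) / 2"
      using ij by (simp add: re_mat_def)
  qed simp
  also have "\<dots> = re_mat (mat_sum n A I) $$ (i, j)"
    using ij by (simp add: re_mat_def mat_sum_def sum.distrib flip: sum_divide_distrib)
  finally show "re_mat (mat_sum n A I) $$ (i, j) = mat_sum n (\<lambda>i. re_mat (A i)) I $$ (i, j)" ..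
qed (auto simp: re_mat_def mat_sum_def)

section \<open>The two inequalities for sums of means\<close>

theorem theorem2p3:
  fixes \<alpha> :: real and n k :: nat
    and A B :: "nat \<Rightarrow> complex mat" and f :: "real \<Rightarrow> real"
  assumes "0 \<le> \<alpha>" and "\<alpha> < pi / 2"
    and "n \<ge> 1" and "k \<ge> 1"
    and "\<And>i. i \<in> {1..k} \<Longrightarrow> A i \<in> sector_mats n \<alpha>"
    and "\<And>i. i \<in> {1..k} \<Longrightarrow> B i \<in> sector_mats n \<alpha>"
    and "f \<in> op_mono_class"
  shows "loewner_le n
           (mat_sum n (\<lambda>i. geom_mean (re_mat (A i)) (re_mat (B i))) {1..k})
           (geom_mean
              (mat_sum n (\<lambda>i. op_mean f (re_mat (A i)) (re_mat (B i))) {1..k})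
              (mat_sum n (\<lambda>i. op_mean (perp_fun f) (re_mat (A i)) (re_mat (B i))) {1..k}))
       \<and> loewner_le n
           (geom_mean
              (mat_sum n (\<lambda>i. op_mean f (re_mat (A i)) (re_mat (B i))) {1..k})
              (mat_sum n (\<lambda>i. op_mean (perp_fun f) (re_mat (A i)) (re_mat (B i))) {1..k}))
           (complex_of_real (1 / (cos \<alpha>)\<^sup>2) \<cdot>\<^sub>m
              geom_mean (re_mat (mat_sum n A {1..k})) (re_mat (mat_sum n B {1..k})))"
proof -
  let ?a = "\<lambda>i. re_mat (A i)" and ?b = "\<lambda>i. re_mat (B i)"
  let ?SA = "mat_sum n ?a {1..k}" and ?SB = "mat_sum n ?b {1..k}"
  let ?P = "\<lambda>i. op_mean f (?a i) (?b i)" and ?Q = "\<lambda>i. op_mean (perp_fun f) (?a i) (?b i)"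
  let ?SP = "mat_sum n ?P {1..k}" and ?SQ = "mat_sum n ?Q {1..k}"
  have fpos: "f x > 0" "perp_fun f x > 0" if "x > 0" for x
    using assms(7) that by (auto simp: op_mono_class_def perp_fun_def)
  have ab: "pos_def n (?a i)" "pos_def n (?b i)" if "i \<in> {1..k}" for i
    using sector_mats_re_pos_def[OF assms(5)[OF that]] sector_mats_re_pos_def[OF assms(6)[OF that]] .
  have PQ: "pos_def n (?P i)" "pos_def n (?Q i)" if "i \<in> {1..k}" for i
    using ab[OF that] fpos by (auto intro!: op_mean_pos_def)
  have S: "pos_def n ?SA" "pos_def n ?SB" "pos_def n ?SP" "pos_def n ?SQ"
    by (rule mat_sum_pos_def[OF assms(4) ab(1)] mat_sum_pos_def[OF assms(4) ab(2)]
        mat_sum_pos_def[OF assms(4) PQ(1)] mat_sum_pos_def[OF assms(4) PQ(2)], assumption)+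
  \<comment> \<open>Rewriting each summand as the geometric mean of \<open>?P i\<close> and
    \<open>?Q i\<close> makes the first inequality an instance of superadditivity.\<close>
  have eq: "mat_sum n (\<lambda>i. geom_mean (?a i) (?b i)) {1..k} = mat_sum n (\<lambda>i. geom_mean (?P i) (?Q i)) {1..k}"
  proof -
    have "geom_mean (?a i) (?b i) = geom_mean (?P i) (?Q i)" if "i \<in> {1..k}" for i
      using geom_mean_op_mean_perp[OF ab[OF that] fpos(1)] by simp
    then show ?thesis unfolding mat_sum_def by (intro eq_matI) auto
  qed
  have left: "loewner_le n (mat_sum n (\<lambda>i. geom_mean (?a i) (?b i)) {1..k}) (geom_mean ?SP ?SQ)"
    unfolding eq
    by (rule mat_sum_superadditive[where m = geom_mean, OF assms(4) PQ op_mean_pos_def op_mean_superadditive])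
       (auto simp: op_mono_class_sqrt)
  have "loewner_le n ?SP (op_mean f ?SA ?SB)"
    by (rule mat_sum_superadditive[where m = "op_mean f", OF assms(4) ab op_mean_pos_def op_mean_superadditive])
       (auto simp: fpos assms(7))
  moreover have "loewner_le n ?SQ (op_mean (perp_fun f) ?SA ?SB)"
    by (rule mat_sum_superadditive[where m = "op_mean (perp_fun f)",
          OF assms(4) ab op_mean_pos_def op_mean_perp_fun_superadditive])
       (auto simp: fpos assms(7))
  ultimately have "loewner_le n (geom_mean ?SP ?SQ)
      (geom_mean (op_mean f ?SA ?SB) (op_mean (perp_fun f) ?SA ?SB))"
    using S fpos by (intro geom_mean_mono op_mean_pos_def)
  \<comment> \<open>The pair of means of the sums recombines to the geometric mean of the
    sums.\<close>
  then have mid: "loewner_le n (geom_mean ?SP ?SQ) (geom_mean ?SA ?SB)"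
    by (simp only: geom_mean_op_mean_perp[OF S(1,2) fpos(1)])
  have G: "pos_def n (geom_mean ?SA ?SB)"
    using S by (intro op_mean_pos_def) auto
  \<comment> \<open>The cosine lies in (0, 1], so the secant factor is at least 1 and can only
    enlarge a positive definite matrix.\<close>
  have "cos \<alpha> > 0" using assms(1,2) by (intro cos_gt_zero_pi) auto
  moreover have "(cos \<alpha>)\<^sup>2 \<le> 1" by (simp add: abs_square_le_1)
  ultimately have "1 / (cos \<alpha>)\<^sup>2 \<ge> 1" by simp
  then have "loewner_le n (geom_mean ?SA ?SB) (complex_of_real (1 / (cos \<alpha>)\<^sup>2) \<cdot>\<^sub>m geom_mean ?SA ?SB)"
    by (rule loewner_le_scale[OF G])
  with mid have "loewner_le n (geom_mean ?SP ?SQ) (complex_of_real (1 / (cos \<alpha>)\<^sup>2) \<cdot>\<^sub>m geom_mean ?SA ?SB)"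
    by (rule loewner_le_trans)
  moreover have "re_mat (mat_sum n A {1..k}) = ?SA" "re_mat (mat_sum n B {1..k}) = ?SB"
    using assms(5,6) by (auto intro!: re_mat_mat_sum simp: sector_mats_def)
  ultimately show ?thesis using left by simp
qed

end
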